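(* Let $n\geq 3$ and let $\Omega\subset\mathbb{R}^n$ be a bounded simple rotationally symmetric domain along the $x_n$ axis. Let $f\in C^1(\mathbb{R})$ be convex, and let $u$ be a positive stable solution of $$-\Delta u=f(u)\ \text{in}\ \Omega,\qquad u=0\ \text{on}\ \partial\Omega.$$ Then: (1) $u$ is rotationally symmetric with respect to the $x_n$ axis; (2) $u_{x_n}<0$ for $x_n>0$; (3) $x_iu_{x_i}<0$ for $x_i\neq 0$, $i=1,2,\dots,n-1$; (4) $\frac{\partial u(r,x_n)}{\partial r}<0$ for $r\neq 0$, where $r=|x'|$, $x'=(x_1,\dots,x_{n-1})$.
   Context: A domain $\Omega$ is $x_i$-convex if for any two points $P,Q\in\Omega$ such that the segment $\overline{PQ}$ is parallel to the $x_i$ axis, one has $\overline{PQ}\subset\Omega$. A domain $\Omega\subset\mathbb{R}^n$ is simple rotationally symmetric along the $x_n$ axis if (1) it is symmetric with respect to the hyperplane $x_n=0$; (2) it is invariant under every orthogonal transformation $A\in O(n)$ fixing the $x_n$ axis; (3) it is $x_i$-convex for every $i=1,\dots,n$. A solution $u$ of $-\Delta u=f(u)$ in $\Omega$, $u=0$ on $\partial\Omega$, is stable if $\int_\Omega|\nabla\phi|^2dx-\int_\Omega f'(u)\phi^2dx>0$ for every nonzero $\phi\in H^1_0(\Omega)$; equivalently, the first Dirichlet eigenvalue of $-\Delta-f'(u)$ in $\Omega$ is positive. *)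

theory Defs
  imports "HOL-Analysis.Analysis"
begin

text \<open>Coordinates of \<open>real ^ 'n\<close>; the distinguished index \<open>k\<close> plays the role of the x_n axis.\<close>

definition partial :: "'n::finite \<Rightarrow> (real^'n \<Rightarrow> real) \<Rightarrow> real^'n \<Rightarrow> real" where
  "partial i u x = deriv (\<lambda>t. u (x + t *\<^sub>R axis i 1)) 0"

definition laplacian :: "(real^'n::finite \<Rightarrow> real) \<Rightarrow> real^'n \<Rightarrow> real" where
  "laplacian u x = (\<Sum>i\<in>UNIV. partial i (partial i u) x)"

definition grad_sq :: "(real^'n::finite \<Rightarrow> real) \<Rightarrow> real^'n \<Rightarrow> real" where
  "grad_sq u x = (\<Sum>i\<in>UNIV. (partial i u x)\<^sup>2)"

definition C2_on :: "(real^'n::finite \<Rightarrow> real) \<Rightarrow> (real^'n) set \<Rightarrow> bool" where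
  "C2_on u S \<longleftrightarrow> u differentiable_on S \<and>
     (\<forall>i. partial i u differentiable_on S) \<and>
     (\<forall>i j. continuous_on S (partial j (partial i u)))"

definition C1c :: "(real^'n::finite) set \<Rightarrow> (real^'n \<Rightarrow> real) set" where
  "C1c S = {\<phi>. \<phi> differentiable_on UNIV \<and> (\<forall>i. continuous_on UNIV (partial i \<phi>)) \<and>
                compact (closure {x. \<phi> x \<noteq> 0}) \<and> closure {x. \<phi> x \<noteq> 0} \<subseteq> S}"

text \<open>First Dirichlet eigenvalue of \<open>-\<Delta> - V\<close> in \<Omega>, via the Rayleigh quotient
  (infimum over the dense class \<open>C^1_c(\<Omega>)\<close> of \<open>H^1_0(\<Omega>)\<close>).\<close>
definition first_dirichlet_eigenvalue ::
  "(real^'n::finite) set \<Rightarrow> (real^'n \<Rightarrow> real) \<Rightarrow> real" where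
  "first_dirichlet_eigenvalue S V =
     Inf {(integral S (\<lambda>x. grad_sq \<phi> x - V x * (\<phi> x)\<^sup>2)) / integral S (\<lambda>x. (\<phi> x)\<^sup>2)
          | \<phi>. \<phi> \<in> C1c S \<and> (\<exists>x. \<phi> x \<noteq> 0)}"

definition stable_solution ::
  "(real \<Rightarrow> real) \<Rightarrow> (real^'n::finite) set \<Rightarrow> (real^'n \<Rightarrow> real) \<Rightarrow> bool" where
  "stable_solution f S u \<longleftrightarrow> first_dirichlet_eigenvalue S (\<lambda>x. deriv f (u x)) > 0"

definition reflect_coord :: "'n::finite \<Rightarrow> real^'n \<Rightarrow> real^'n" where
  "reflect_coord k x = (\<chi> j. if j = k then - (x $ j) else x $ j)"

definition axis_convex :: "'n::finite \<Rightarrow> (real^'n) set \<Rightarrow> bool" where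
  "axis_convex i S \<longleftrightarrow> (\<forall>P\<in>S. \<forall>Q\<in>S. (\<forall>j. j \<noteq> i \<longrightarrow> P $ j = Q $ j) \<longrightarrow> closed_segment P Q \<subseteq> S)"

definition axis_rotation :: "'n::finite \<Rightarrow> (real^'n \<Rightarrow> real^'n) \<Rightarrow> bool" where
  "axis_rotation k T \<longleftrightarrow> orthogonal_transformation T \<and> T (axis k 1) = axis k 1"

definition simple_rot_sym :: "'n::finite \<Rightarrow> (real^'n) set \<Rightarrow> bool" where
  "simple_rot_sym k S \<longleftrightarrow>
     reflect_coord k ` S = S \<and>
     (\<forall>T. axis_rotation k T \<longrightarrow> T ` S = S) \<and>
     (\<forall>i. axis_convex i S)"

definition is_domain :: "(real^'n::finite) set \<Rightarrow> bool" where
  "is_domain S \<longleftrightarrow> open S \<and> connected S \<and> S \<noteq> {}"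

definition horiz :: "'n::finite \<Rightarrow> real^'n \<Rightarrow> real^'n" where
  "horiz k x = x - (x $ k) *\<^sub>R axis k 1"

end

theory Submission
  imports Defs
begin

text \<open>
  The first Dirichlet eigenvalue of \<open>-\<Delta> - f'(u)\<close> being positive gives a weak maximum principle
  for this operator on every open \<open>D \<subseteq> \<Omega>\<close>, tested with smoothed versions of the positive part.
  If \<open>A\<close> is a rigid motion mapping \<open>D\<close> into \<open>\<Omega>\<close>, convexity of \<open>f\<close> makes \<open>w = u - u \<circ> A\<close> a
  subsolution, so \<open>u \<le> u \<circ> A\<close> on \<open>D\<close> as soon as this holds on the boundary. With \<open>D = \<Omega>\<close> and
  rotations this is the symmetry of \<open>u\<close>. With the cap \<open>D = {x \<in> \<Omega>. x $ i > l}\<close>, \<open>l > 0\<close>, and the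
  reflection in \<open>x $ i = l\<close> it compares \<open>u\<close> with its mirror image for every \<open>l\<close> at once, so no
  plane has to be moved. Strictness of the derivative comes from an explicit barrier on a thin tube
  along the axis direction, which serves as strong maximum principle and Hopf lemma together.
\<close>

text \<open>The eigenvalue is an infimum over \<open>C1c\<close> functions only, so the positive
  part of \<open>w\<close> is not an admissible test function: it has a kink, and its support may
  reach a boundary of unknown regularity. A C^1 function of \<open>w\<close> that vanishes where
  \<open>w\<close> is at most \<open>e\<close> cures both defects: since \<open>w\<close> is
  nonpositive on the boundary, the set where \<open>w\<close> is at least \<open>e\<close> is
  compact inside \<open>D\<close>. All integration by parts then concerns compactly supported
  functions on the whole space. The price is an error of order \<open>e\<close>, which the positive
  eigenvalue beats as \<open>e\<close> tends to 0.

  Planes need not be moved because stability gives the maximum principle on every open subset, not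
  only on narrow ones. Strictness is wanted at a point of the mirror plane, whereas \<open>w\<close>
  is known to be negative only near the point where the axis-parallel line leaves the domain. A tube
  joins the two places, and its barrier turns the negative sign at one end into a negative slope at
  the other.\<close>

section \<open>Partial derivatives and integration by parts\<close>

text \<open>Difference quotients of \<open>F\<close> integrate to 0 because Lebesgue measure is
  translation invariant, and dominated convergence passes this on to the derivative. Only
  differentiability along \<open>e\<close> is asked for, which is what a single term of a divergence
  provides.\<close>

lemma integral_line_derivative_eq_0:
  fixes F P :: "'a::euclidean_space \<Rightarrow> real"
  assumes der: "\<And>x. ((\<lambda>t. F (x + t *\<^sub>R e)) has_real_derivative P x) (at 0)"
    and cF: "continuous_on UNIV F" and cP: "continuous_on UNIV P"
    and supp: "\<And>x. norm x > R \<Longrightarrow> F x = 0" "\<And>x. norm x > R \<Longrightarrow> P x = 0"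
  shows "(P has_integral 0) UNIV"
proof -
  have integ: "integrable lborel f"
    if "continuous_on UNIV f" "\<And>x. norm x > r \<Longrightarrow> f x = 0" for f :: "'a \<Rightarrow> real" and r
  proof -
    have "integrable lborel (\<lambda>x. indicator (cball 0 r) x *\<^sub>R f x)"
      by (rule borel_integrable_compact) (auto intro: continuous_on_subset[OF that(1)])
    moreover have "(\<lambda>x. indicator (cball 0 r) x *\<^sub>R f x) = f"
      using that(2) by (force simp: indicator_def)
    ultimately show ?thesis by simp
  qed
  have "bounded (P ` cball 0 R)"
    by (intro compact_imp_bounded compact_continuous_image continuous_on_subset[OF cP]) auto
  then obtain B0 where B0: "\<And>x. norm x \<le> R \<Longrightarrow> \<bar>P x\<bar> \<le> B0"
    unfolding bounded_iff by (metis imageI mem_cball_0 real_norm_def)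
  define B where "B = max B0 0"
  have B: "\<bar>P x\<bar> \<le> B" for x
    using B0[of x] supp(2)[of x] unfolding B_def by (cases "norm x \<le> R") auto
  have B_nonneg: "B \<ge> 0" unfolding B_def by simp
  have der': "((\<lambda>t. F (x + t *\<^sub>R e)) has_real_derivative P (x + s *\<^sub>R e)) (at s)" for x s
  proof -
    have "((\<lambda>t. F (x + t *\<^sub>R e)) has_real_derivative P (x + s *\<^sub>R e)) (at (0 + s))"
      using der[of "x + s *\<^sub>R e"] by (subst DERIV_shift) (simp add: algebra_simps)
    then show ?thesis by simp
  qed
  define g where "g k x = (F (x + (1 / real (Suc k)) *\<^sub>R e) - F x) * real (Suc k)" for k x
  have shift: "integrable lborel (\<lambda>x. F (x + c))" "(LINT x|lborel. F (x + c)) = (LINT x|lborel. F x)" for c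
  proof -
    have F: "F \<in> borel_measurable borel"
      using cF by (simp add: borel_measurable_continuous_onI)
    have "(LINT x|lborel. F x) = (LINT x|distr lborel borel ((+) c). F x)"
      by (simp add: lborel_distr_plus)
    also have "\<dots> = (LINT x|lborel. F (c + x))"
      using F by (subst integral_distr) auto
    finally show "(LINT x|lborel. F (x + c)) = (LINT x|lborel. F x)"
      by (simp add: add.commute)
    have "integrable (distr lborel borel ((+) c)) F"
      using integ[OF cF supp(1)] by (simp add: lborel_distr_plus)
    then show "integrable lborel (\<lambda>x. F (x + c))"
      using F by (subst (asm) integrable_distr_eq) (auto simp: add.commute)
  qed
  have g0: "(LINT x|lborel. g k x) = 0" for k
    unfolding g_def using shift integ[OF cF supp(1)] by simp
  have lim: "(\<lambda>k. g k x) \<longlonglongrightarrow> P x" for x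
  proof -
    have "(\<lambda>h. (F (x + h *\<^sub>R e) - F x) / h) \<midarrow>0\<rightarrow> P x"
      using der[of x] by (simp add: DERIV_def)
    moreover have "filterlim (\<lambda>k. 1 / real (Suc k)) (at 0) sequentially"
      unfolding filterlim_at using LIMSEQ_inverse_real_of_nat by (auto simp: inverse_eq_divide)
    ultimately have "(\<lambda>k. (F (x + (1 / real (Suc k)) *\<^sub>R e) - F x) / (1 / real (Suc k))) \<longlonglongrightarrow> P x"
      by (rule filterlim_compose)
    then show ?thesis unfolding g_def by simp
  qed
  \<comment> \<open>By the mean value theorem the quotient is a value of \<open>P\<close> at
    distance at most \<open>norm e\<close> from \<open>x\<close>, since the step lengths are at most
    1. This gives one dominating function for all \<open>k\<close>.\<close>
  have bound: "\<bar>g k x\<bar> \<le> B * indicator (cball 0 (R + norm e)) x" for k x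
  proof -
    define h where "h = 1 / real (Suc k)"
    have h: "0 < h" "h \<le> 1" unfolding h_def by auto
    obtain z where z: "0 < z" "z < h" "F (x + h *\<^sub>R e) - F (x + 0 *\<^sub>R e) = (h - 0) * P (x + z *\<^sub>R e)"
      using MVT2[of 0 h "\<lambda>t. F (x + t *\<^sub>R e)" "\<lambda>t. P (x + t *\<^sub>R e)"] der' h(1) by blast
    have gz: "g k x = P (x + z *\<^sub>R e)"
    proof -
      have "g k x = (F (x + h *\<^sub>R e) - F x) * real (Suc k)" unfolding g_def h_def ..
      also have "\<dots> = h * P (x + z *\<^sub>R e) * real (Suc k)" using z(3) by simp
      also have "\<dots> = P (x + z *\<^sub>R e)" by (simp add: h_def)
      finally show ?thesis .
    qed
    show ?thesis
    proof (cases "norm x \<le> R + norm e")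
      case True
      then show ?thesis using B gz by simp
    next
      case False
      have "norm x \<le> norm (x + z *\<^sub>R e) + norm (z *\<^sub>R e)"
        by (metis add_diff_cancel norm_triangle_ineq4)
      moreover have "norm (z *\<^sub>R e) \<le> norm e"
        using z h by (simp add: mult_left_le_one_le)
      ultimately show ?thesis using False supp(2)[of "x + z *\<^sub>R e"] gz by simp
    qed
  qed
  have "(\<lambda>k. LINT x|lborel. g k x) \<longlonglongrightarrow> (LINT x|lborel. P x)"
  proof (rule integral_dominated_convergence)
    show "integrable lborel (\<lambda>x. B * indicator (cball 0 (R + norm e)) x)"
      using emeasure_bounded_finite[of "cball 0 (R + norm e)"]
      by (intro integrable_mult_right integrable_real_indicator) (simp_all add: infinity_ennreal_def)
    show "P \<in> borel_measurable lborel"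
      using cP by (simp add: borel_measurable_continuous_onI)
    have "F \<in> borel_measurable borel"
      using cF by (simp add: borel_measurable_continuous_onI)
    then show "g k \<in> borel_measurable lborel" for k
      unfolding g_def by measurable
  qed (use lim bound in auto)
  then have "(LINT x|lborel. P x) = 0"
    unfolding g0 by (simp add: LIMSEQ_const_iff)
  moreover have "(P has_integral (LINT x|lborel. P x)) UNIV"
    by (rule has_integral_integral_lborel[OF integ[OF cP supp(2)]])
  ultimately show ?thesis by metis
qed

section \<open>Partial derivatives and the Frechet derivative\<close>

lemma has_derivative_partial:
  fixes u :: "real^'n \<Rightarrow> real"
  assumes "u differentiable (at x)"
  shows "(u has_derivative (\<lambda>h. \<Sum>a\<in>UNIV. h $ a * partial a u x)) (at x)"
proof -
  obtain d where d: "(u has_derivative d) (at x)" using assms by (auto simp: differentiable_def)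
  interpret bounded_linear d using d by (rule has_derivative_bounded_linear)
  have line: "((\<lambda>t. u (x + t *\<^sub>R v)) has_real_derivative d v) (at 0)" for v
  proof -
    have "((\<lambda>t. x + t *\<^sub>R v) has_derivative (\<lambda>t. t *\<^sub>R v)) (at 0)"
      by (auto intro!: derivative_eq_intros)
    moreover have "(u has_derivative d) (at (x + 0 *\<^sub>R v))" using d by simp
    ultimately have "((\<lambda>t. u (x + t *\<^sub>R v)) has_derivative (\<lambda>t. d (t *\<^sub>R v))) (at 0)"
      using diff_chain_at[of "\<lambda>t. x + t *\<^sub>R v" "\<lambda>t. t *\<^sub>R v" 0 u d] by (simp add: o_def)
    then show ?thesis by (simp add: has_field_derivative_def scaleR mult_commute_abs)
  qed
  have p: "partial a u x = d (axis a 1)" for a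
    unfolding partial_def using line by (rule DERIV_imp_deriv)
  have "d h = (\<Sum>a\<in>UNIV. h $ a * partial a u x)" for h
  proof -
    have "d h = d (\<Sum>a\<in>UNIV. h $ a *s axis a 1)" by (simp add: basis_expansion)
    also have "\<dots> = (\<Sum>a\<in>UNIV. h $ a * d (axis a 1))"
      by (simp add: sum scaleR scalar_mult_eq_scaleR)
    finally show ?thesis using p by simp
  qed
  with d show ?thesis by (metis (no_types, lifting) has_derivative_transform UNIV_I ext)
qed

lemma DERIV_line:
  fixes u :: "real^'n \<Rightarrow> real"
  assumes "u differentiable (at (x + s *\<^sub>R v))"
  shows "((\<lambda>t. u (x + t *\<^sub>R v)) has_real_derivative (\<Sum>a\<in>UNIV. v $ a * partial a u (x + s *\<^sub>R v))) (at s)"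
proof -
  have "((\<lambda>t. x + t *\<^sub>R v) has_derivative (\<lambda>t. t *\<^sub>R v)) (at s)"
    by (auto intro!: derivative_eq_intros)
  from diff_chain_at[OF this has_derivative_partial[OF assms]]
  have "((\<lambda>t. u (x + t *\<^sub>R v)) has_derivative (\<lambda>t. \<Sum>a\<in>UNIV. (t *\<^sub>R v) $ a * partial a u (x + s *\<^sub>R v))) (at s)"
    by (simp add: o_def)
  then show ?thesis
    by (simp add: has_field_derivative_def mult.assoc flip: sum_distrib_left)
       (simp add: mult_commute_abs)
qed

lemma sum_axis:
  fixes g :: "'n::finite \<Rightarrow> real"
  shows "(\<Sum>a\<in>UNIV. axis i 1 $ a * g a) = g i"
proof -
  have "(\<Sum>a\<in>UNIV. axis i 1 $ a * g a) = (\<Sum>a\<in>UNIV. if a = i then g a else 0)"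
    by (intro sum.cong) (auto simp: axis_def)
  then show ?thesis by simp
qed

lemma DERIV_partial:
  fixes u :: "real^'n \<Rightarrow> real"
  assumes "u differentiable (at (x + s *\<^sub>R axis i 1))"
  shows "((\<lambda>t. u (x + t *\<^sub>R axis i 1)) has_real_derivative partial i u (x + s *\<^sub>R axis i 1)) (at s)"
  using DERIV_line[OF assms] by (simp add: sum_axis)

lemma partial_eqI:
  assumes "(u has_derivative D) (at x)"
  shows "partial i u x = D (axis i 1)"
proof -
  interpret bounded_linear D using assms by (rule has_derivative_bounded_linear)
  have "((\<lambda>t. x + t *\<^sub>R axis i 1) has_derivative (\<lambda>t. t *\<^sub>R axis i 1)) (at 0)"
    by (auto intro!: derivative_eq_intros)
  moreover have "(u has_derivative D) (at (x + 0 *\<^sub>R axis i 1))" using assms by simp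
  ultimately have "((\<lambda>t. u (x + t *\<^sub>R axis i 1)) has_derivative (\<lambda>t. D (t *\<^sub>R axis i 1))) (at 0)"
    using diff_chain_at[of "\<lambda>t. x + t *\<^sub>R axis i 1" "\<lambda>t. t *\<^sub>R axis i 1" 0 u D] by (simp add: o_def)
  then show ?thesis unfolding partial_def
    by (intro DERIV_imp_deriv) (simp add: has_field_derivative_def scaleR mult_commute_abs)
qed

lemma eventually_line_in_open:
  fixes x v :: "'a::real_normed_vector"
  assumes "open U" "x \<in> U"
  shows "\<forall>\<^sub>F t in nhds 0. x + t *\<^sub>R v \<in> U"
proof -
  have "continuous (at 0) (\<lambda>t. x + t *\<^sub>R v)" by (intro continuous_intros)
  then have "((\<lambda>t. x + t *\<^sub>R v) \<longlongrightarrow> x) (at 0)"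
    by (simp add: continuous_at)
  then show ?thesis
    using assms by (simp add: topological_tendstoD eventually_nhds_conv_at)
qed

lemma partial_cong_open:
  assumes "open D" "x \<in> D" "\<And>y. y \<in> D \<Longrightarrow> u y = v y"
  shows "partial i u x = partial i v x"
  unfolding partial_def
proof (rule deriv_cong_ev)
  from eventually_line_in_open[OF assms(1,2), of "axis i 1"]
  show "\<forall>\<^sub>F t in nhds 0. u (x + t *\<^sub>R axis i 1) = v (x + t *\<^sub>R axis i 1)"
    by eventually_elim (rule assms(3))
qed simp

section \<open>A smoothed positive part\<close>

lemma has_real_derivative_If:
  fixes f g :: "real \<Rightarrow> real"
  assumes f: "s \<le> a \<Longrightarrow> (f has_real_derivative d) (at s)"
    and g: "a \<le> s \<Longrightarrow> (g has_real_derivative d) (at s)"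
    and eq: "f a = g a"
  shows "((\<lambda>s. if s \<le> a then f s else g s) has_real_derivative d) (at s)"
proof (cases s a rule: linorder_cases)
  case less
  have "\<forall>\<^sub>F t in nhds s. t < a" using less by (rule order_tendstoD(2)[OF filterlim_ident])
  then have "\<forall>\<^sub>F t in nhds s. (if t \<le> a then f t else g t) = f t" by eventually_elim simp
  then show ?thesis using f less by (subst DERIV_cong_ev) auto
next
  case greater
  have "\<forall>\<^sub>F t in nhds s. a < t" using greater by (rule order_tendstoD(1)[OF filterlim_ident])
  then have "\<forall>\<^sub>F t in nhds s. (if t \<le> a then f t else g t) = g t" by eventually_elim simp
  then show ?thesis using g greater by (subst DERIV_cong_ev) auto
next
  case equal
  let ?F = "\<lambda>s. if s \<le> a then f s else g s"
  have "(?F has_real_derivative d) (at s within {..a})"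
    using f equal
    by (intro has_field_derivative_transform_within[OF has_field_derivative_at_within[of f d s "{..a}"], of 1 ?F]) auto
  moreover have "(?F has_real_derivative d) (at s within {a..})"
    using g equal eq
    by (intro has_field_derivative_transform_within[OF has_field_derivative_at_within[of g d s "{a..}"], of 1 ?F]) auto
  ultimately have "(?F has_real_derivative d) (at s within ({..a} \<union> {a..}))"
    by (simp add: has_field_derivative_iff Lim_within_Un)
  moreover have "{..a} \<union> {a..} = UNIV" by auto
  ultimately show ?thesis by simp
qed

text \<open>For \<open>s > e\<close> this is s - 2 e + e^2 / s, a C^1 approximation of the positive
  part. Its derivative 1 - (e / s)^2 has a square whose primitive is again rational, so that all
  later estimates are polynomial algebra.\<close>

definition cutoff :: "real \<Rightarrow> real \<Rightarrow> real" where
  "cutoff e s = (if s \<le> e then 0 else (s - e)\<^sup>2 / s)"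

text \<open>Writing \<open>max e s\<close> merges the two branches, which makes continuity at
  \<open>s = e\<close> immediate.\<close>

definition cutoff_deriv :: "real \<Rightarrow> real \<Rightarrow> real" where
  "cutoff_deriv e s = 1 - (e / max e s)\<^sup>2"

text \<open>For \<open>s > e\<close> this is s - 8 e / 3 + 2 e^2 / s - e^4 / (3 s^3), the constant
  being fixed by vanishing at \<open>e\<close>. The factored form displays the sign.\<close>

definition cutoff_energy :: "real \<Rightarrow> real \<Rightarrow> real" where
  "cutoff_energy e s = (if s \<le> e then 0 else (s - e) ^ 3 * (3 * s + e) / (3 * s ^ 3))"

context
  fixes e :: real
  assumes e: "e > 0"
begin

lemma DERIV_cutoff: "(cutoff e has_real_derivative cutoff_deriv e s) (at s)"
  unfolding cutoff_def
proof (rule has_real_derivative_If)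
  assume "s \<le> e"
  then have "cutoff_deriv e s = 0" using e by (simp add: cutoff_deriv_def)
  then show "((\<lambda>s. 0) has_real_derivative cutoff_deriv e s) (at s)" by simp
next
  assume s: "e \<le> s"
  show "((\<lambda>s. (s - e)\<^sup>2 / s) has_real_derivative cutoff_deriv e s) (at s)"
    using s e unfolding cutoff_deriv_def
    by (auto intro!: derivative_eq_intros simp: max_def power2_eq_square field_simps)
qed simp

lemma DERIV_cutoff_energy: "(cutoff_energy e has_real_derivative (cutoff_deriv e s)\<^sup>2) (at s)"
  unfolding cutoff_energy_def
proof (rule has_real_derivative_If)
  assume "s \<le> e"
  then have "cutoff_deriv e s = 0" using e by (simp add: cutoff_deriv_def)
  then show "((\<lambda>s. 0) has_real_derivative (cutoff_deriv e s)\<^sup>2) (at s)" by simp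
next
  assume s: "e \<le> s"
  then have [simp]: "s \<noteq> 0" "s > 0" "max e s = s" using e by auto
  have "((\<lambda>s. (s - e) ^ 3 * (3 * s + e) / (3 * s ^ 3)) has_real_derivative
     ((3 * (s - e)\<^sup>2 * (3 * s + e) + (s - e) ^ 3 * 3) * (3 * s ^ 3)
        - (s - e) ^ 3 * (3 * s + e) * (9 * s\<^sup>2)) / (3 * s ^ 3)\<^sup>2) (at s)"
    by (auto intro!: derivative_eq_intros simp: power2_eq_square field_simps)
  moreover have "((3 * (s - e)\<^sup>2 * (3 * s + e) + (s - e) ^ 3 * 3) * (3 * s ^ 3)
        - (s - e) ^ 3 * (3 * s + e) * (9 * s\<^sup>2)) / (3 * s ^ 3)\<^sup>2 = (cutoff_deriv e s)\<^sup>2"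
    unfolding cutoff_deriv_def
    by (simp add: divide_simps) (simp add: algebra_simps power2_eq_square power3_eq_cube power_mult_distrib eval_nat_numeral)
  ultimately show "((\<lambda>s. (s - e) ^ 3 * (3 * s + e) / (3 * s ^ 3)) has_real_derivative (cutoff_deriv e s)\<^sup>2) (at s)"
    by simp
qed simp

lemma continuous_cutoff_deriv: "continuous_on UNIV (cutoff_deriv e)"
  unfolding cutoff_deriv_def using e by (intro continuous_intros) (auto simp: max_def)

lemma cutoff_eq_0: "s \<le> e \<Longrightarrow> cutoff e s = 0"
  and cutoff_deriv_eq_0: "s \<le> e \<Longrightarrow> cutoff_deriv e s = 0"
  and cutoff_energy_eq_0: "s \<le> e \<Longrightarrow> cutoff_energy e s = 0"
  using e by (auto simp: cutoff_def cutoff_deriv_def cutoff_energy_def)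

lemma cutoff_energy_nonneg: "cutoff_energy e s \<ge> 0"
  using e by (auto simp: cutoff_energy_def)

text \<open>For \<open>s > e\<close> the difference factors exactly as 4/3 e (s - e)^3 / s^2. The
  factor \<open>e\<close> is what lets the error of the test vanish in the limit.\<close>

lemma cutoff_defect:
  assumes "s \<ge> 0"
  shows "\<bar>s * cutoff_energy e s - (cutoff e s)\<^sup>2\<bar> \<le> 4 / 3 * e * s"
proof (cases "s \<le> e")
  case True
  then show ?thesis using e assms by (simp add: cutoff_eq_0 cutoff_energy_eq_0)
next
  case False
  then have s: "s > e" "s > 0" using e by auto
  have eq: "s * cutoff_energy e s - (cutoff e s)\<^sup>2 = 4 / 3 * e * ((s - e) ^ 3 / s\<^sup>2)"
    using s unfolding cutoff_energy_def cutoff_def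
    by (simp add: divide_simps) (simp add: algebra_simps power2_eq_square power3_eq_cube eval_nat_numeral)
  have le: "(s - e) ^ 3 / s\<^sup>2 \<le> s"
  proof -
    have "(s - e) ^ 3 \<le> s ^ 3" using s e by (intro power_mono) auto
    then show ?thesis using s by (simp add: divide_simps power2_eq_square power3_eq_cube)
  qed
  moreover have "\<bar>4 / 3 * e * ((s - e) ^ 3 / s\<^sup>2)\<bar> = 4 / 3 * e * ((s - e) ^ 3 / s\<^sup>2)"
    using e s by (intro abs_of_nonneg mult_nonneg_nonneg divide_nonneg_nonneg zero_le_power) auto
  moreover have "4 / 3 * e * ((s - e) ^ 3 / s\<^sup>2) \<le> 4 / 3 * e * s"
    using e le by (intro mult_left_mono) auto
  ultimately show ?thesis unfolding eq by linarith
qed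

end

section \<open>The stability inequality\<close>

lemma C2_onD:
  assumes "C2_on u S" "open S" "x \<in> S"
  shows "u differentiable (at x)" "partial i u differentiable (at x)"
  using assms by (auto simp: C2_on_def differentiable_on_eq_differentiable_at)

lemma C2_on_continuous:
  assumes "C2_on u S" 
  shows "continuous_on S u" "continuous_on S (partial i u)" "continuous_on S (partial j (partial i u))"
  using assms by (auto simp: C2_on_def intro: differentiable_imp_continuous_on)

lemma integrable_on_bounded_open:
  fixes g :: "'a::euclidean_space \<Rightarrow> real"
  assumes "open S" "bounded S" "continuous_on S g" "\<And>x. x \<in> S \<Longrightarrow> \<bar>g x\<bar> \<le> B"
  shows "g integrable_on S"
proof -
  have S: "S \<in> lmeasurable"
    using assms(1,2) by (simp add: lmeasurable_open)
  have "(\<lambda>x. B) integrable_on S"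
    using S integrable_on_const by blast
  moreover have "g \<in> borel_measurable (lebesgue_on S)"
    using assms(3) S by (intro continuous_imp_measurable_on_sets_lebesgue) auto
  ultimately have "g absolutely_integrable_on S"
    using S assms(4) by (intro measurable_bounded_by_integrable_imp_absolutely_integrable[where g = "\<lambda>x. B"]) auto
  then show ?thesis by (rule absolutely_integrable_on_def[THEN iffD1, THEN conjunct1])
qed

lemma C1c_bounds:
  assumes "\<phi> \<in> C1c S"
  obtains B where "\<And>x. (\<phi> x)\<^sup>2 \<le> B" "\<And>x. grad_sq \<phi> x \<le> B"
proof -
  define K where "K = closure {x. \<phi> x \<noteq> 0}"
  have K: "compact K" and d: "\<phi> differentiable_on UNIV"
    and p: "\<And>i. continuous_on UNIV (partial i \<phi>)"
    using assms by (auto simp: C1c_def K_def)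
  have out: "\<phi> x = 0" "grad_sq \<phi> x = 0" if "x \<notin> K" for x
  proof -
    have *: "\<phi> y = 0" if "y \<in> - K" for y
      using that closure_subset[of "{x. \<phi> x \<noteq> 0}"] by (auto simp: K_def)
    then show "\<phi> x = 0" using that by simp
    have "partial i \<phi> x = partial i (\<lambda>_. 0) x" for i
      using K that * by (intro partial_cong_open[of "- K"]) (auto simp: compact_imp_closed open_Compl)
    moreover have "partial i (\<lambda>_. 0) x = 0" for i by (simp add: partial_def)
    ultimately show "grad_sq \<phi> x = 0" by (simp add: grad_sq_def)
  qed
  have c: "continuous_on K (\<lambda>x. (\<phi> x)\<^sup>2)" "continuous_on K (grad_sq \<phi>)"
    unfolding grad_sq_def
    by (intro continuous_intros continuous_on_subset[OF differentiable_imp_continuous_on[OF d]]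
        continuous_on_subset[OF p]; simp)+
  have "bounded ((\<lambda>x. (\<phi> x)\<^sup>2) ` K)" "bounded (grad_sq \<phi> ` K)"
    using c K by (auto intro: compact_imp_bounded compact_continuous_image)
  then obtain B1 B2 where B: "\<And>x. x \<in> K \<Longrightarrow> norm ((\<phi> x)\<^sup>2) \<le> B1" "\<And>x. x \<in> K \<Longrightarrow> norm (grad_sq \<phi> x) \<le> B2"
    unfolding bounded_iff by (metis imageI)
  have "(\<phi> x)\<^sup>2 \<le> max (max B1 B2) 0" "grad_sq \<phi> x \<le> max (max B1 B2) 0" for x
    using B[of x] out[of x] by (cases "x \<in> K"; force)+
  then show ?thesis by (rule that)
qed

lemma grad_sq_nonneg: "grad_sq \<phi> x \<ge> 0"
  by (simp add: grad_sq_def sum_nonneg)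

text \<open>A real infimum is a lower bound of its set only if the set is bounded below; here
  \<open>- M\<close> bounds all the quotients, because \<open>V\<close> is at most \<open>M\<close>
  on \<open>S\<close>.\<close>

lemma rayleigh_bound:
  fixes S :: "(real^'n) set"
  assumes S: "open S" "bounded S" and V: "continuous_on S V" "\<And>x. x \<in> S \<Longrightarrow> \<bar>V x\<bar> \<le> M" and "M \<ge> 0"
    and pos: "first_dirichlet_eigenvalue S V > 0"
    and \<phi>: "\<phi> \<in> C1c S" "\<exists>x. \<phi> x \<noteq> 0"
  shows "first_dirichlet_eigenvalue S V * integral S (\<lambda>x. (\<phi> x)\<^sup>2) \<le> integral S (\<lambda>x. grad_sq \<phi> x - V x * (\<phi> x)\<^sup>2)"
    and "(\<lambda>x. (\<phi> x)\<^sup>2) integrable_on S" and "(\<lambda>x. grad_sq \<phi> x - V x * (\<phi> x)\<^sup>2) integrable_on S"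
proof -
  have int: "(\<lambda>x. (\<psi> x)\<^sup>2) integrable_on S" "(\<lambda>x. grad_sq \<psi> x - V x * (\<psi> x)\<^sup>2) integrable_on S"
    if \<psi>: "\<psi> \<in> C1c S" for \<psi>
  proof -
    obtain B where B: "\<And>x. (\<psi> x)\<^sup>2 \<le> B" "\<And>x. grad_sq \<psi> x \<le> B" using C1c_bounds[OF \<psi>] by metis
    have d: "\<psi> differentiable_on UNIV" and p: "\<And>i. continuous_on UNIV (partial i \<psi>)"
      using \<psi> by (auto simp: C1c_def)
    have c: "continuous_on S \<psi>" "continuous_on S (grad_sq \<psi>)"
      unfolding grad_sq_def
      by (intro continuous_intros continuous_on_subset[OF differentiable_imp_continuous_on[OF d]]
        continuous_on_subset[OF p]; simp)+
    show "(\<lambda>x. (\<psi> x)\<^sup>2) integrable_on S"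
      using B by (intro integrable_on_bounded_open[OF S] continuous_intros c) auto
    show "(\<lambda>x. grad_sq \<psi> x - V x * (\<psi> x)\<^sup>2) integrable_on S"
    proof (intro integrable_on_bounded_open[OF S, where B = "B + M * B"] continuous_intros c V(1))
      fix x assume "x \<in> S"
      then have "\<bar>V x * (\<psi> x)\<^sup>2\<bar> \<le> M * B"
        unfolding abs_mult using V(2) B(1)[of x] \<open>M \<ge> 0\<close> by (intro mult_mono) auto
      then show "\<bar>grad_sq \<psi> x - V x * (\<psi> x)\<^sup>2\<bar> \<le> B + M * B"
        using B(2)[of x] grad_sq_nonneg[of \<psi> x] by linarith
    qed
  qed
  define Q where "Q \<psi> = integral S (\<lambda>x. grad_sq \<psi> x - V x * (\<psi> x)\<^sup>2) / integral S (\<lambda>x. (\<psi> x)\<^sup>2)" for \<psi>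
  have nn: "integral S (\<lambda>x. (\<psi> x)\<^sup>2) \<ge> 0" if "\<psi> \<in> C1c S" for \<psi>
    using int(1)[OF that] by (rule integral_nonneg) simp
  have "Q \<psi> \<ge> - M" if \<psi>: "\<psi> \<in> C1c S" for \<psi>
  proof -
    have "- M * integral S (\<lambda>x. (\<psi> x)\<^sup>2) = integral S (\<lambda>x. - M * (\<psi> x)\<^sup>2)" by simp
    also have "\<dots> \<le> integral S (\<lambda>x. grad_sq \<psi> x - V x * (\<psi> x)\<^sup>2)"
    proof (rule integral_le)
      show "(\<lambda>x. - M * (\<psi> x)\<^sup>2) integrable_on S" using int(1)[OF \<psi>] by (rule integrable_on_mult_right)
      fix x assume "x \<in> S"
      then have "V x * (\<psi> x)\<^sup>2 \<le> M * (\<psi> x)\<^sup>2" using V(2)[of x] by (intro mult_right_mono) auto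
      then show "- M * (\<psi> x)\<^sup>2 \<le> grad_sq \<psi> x - V x * (\<psi> x)\<^sup>2" using grad_sq_nonneg[of \<psi> x] by simp
    qed (rule int(2)[OF \<psi>])
    finally show ?thesis using nn[OF \<psi>] \<open>M \<ge> 0\<close> unfolding Q_def
      by (cases "integral S (\<lambda>x. (\<psi> x)\<^sup>2) = 0") (auto simp: divide_simps)
  qed
  then have "bdd_below {Q \<psi> |\<psi>. \<psi> \<in> C1c S \<and> (\<exists>x. \<psi> x \<noteq> 0)}"
    by (intro bdd_belowI[of _ "- M"]) auto
  then have Q: "first_dirichlet_eigenvalue S V \<le> Q \<phi>"
    unfolding first_dirichlet_eigenvalue_def Q_def[symmetric] using \<phi> by (intro cInf_lower) auto
  \<comment> \<open>If the integral were 0, the quotient would be 0 by the convention for division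
    by 0, against its being at least the positive eigenvalue.\<close>
  then have "integral S (\<lambda>x. (\<phi> x)\<^sup>2) > 0"
    using pos nn[OF \<phi>(1)] unfolding Q_def by (cases "integral S (\<lambda>x. (\<phi> x)\<^sup>2) = 0") auto
  with Q show "first_dirichlet_eigenvalue S V * integral S (\<lambda>x. (\<phi> x)\<^sup>2) \<le> integral S (\<lambda>x. grad_sq \<phi> x - V x * (\<phi> x)\<^sup>2)"
    unfolding Q_def by (simp add: field_simps)
  show "(\<lambda>x. (\<phi> x)\<^sup>2) integrable_on S" "(\<lambda>x. grad_sq \<phi> x - V x * (\<phi> x)\<^sup>2) integrable_on S"
    using int[OF \<phi>(1)] by auto
qed

section \<open>Extension by zero off a closed set\<close>

lemma continuous_extend_0:
  fixes g :: "'a::topological_space \<Rightarrow> real"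
  assumes "open D" "closed K" "K \<subseteq> D" "continuous_on D g" "\<And>x. x \<in> D \<Longrightarrow> x \<notin> K \<Longrightarrow> g x = 0"
  shows "continuous_on UNIV (\<lambda>x. if x \<in> D then g x else 0)"
proof -
  have "continuous_on D (\<lambda>x. if x \<in> D then g x else 0)"
    using assms(4) by (simp cong: continuous_on_cong)
  moreover have "continuous_on (- K) (\<lambda>x. if x \<in> D then g x else 0)"
    using assms(5) by (subst continuous_on_cong[OF refl, of _ _ "\<lambda>_. 0"]) auto
  ultimately have "continuous_on (D \<union> - K) (\<lambda>x. if x \<in> D then g x else 0)"
    using assms(1,2) by (intro continuous_on_open_Un) auto
  moreover have "D \<union> - K = UNIV" using assms(3) by auto
  ultimately show ?thesis by simp
qed

section \<open>The weak maximum principle\<close>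

lemma partial_extend_0:
  assumes "open D" "closed K" "\<And>x. x \<in> D \<Longrightarrow> x \<notin> K \<Longrightarrow> g x = 0" "K \<subseteq> D"
  shows "partial i (\<lambda>x. if x \<in> D then g x else 0) x = (if x \<in> D then partial i g x else 0)"
proof (cases "x \<in> D")
  case True
  then show ?thesis using partial_cong_open[OF assms(1) True, of "\<lambda>x. if x \<in> D then g x else 0" g] by simp
next
  case False
  then have "partial i (\<lambda>x. if x \<in> D then g x else 0) x = partial i (\<lambda>_. 0) x"
    using assms by (intro partial_cong_open[of "- K"]) (auto simp: open_Compl)
  then show ?thesis using False by (simp add: partial_def)
qed

lemma differentiable_extend_0:
  fixes g :: "'a::real_normed_vector \<Rightarrow> real"
  assumes "open D" "closed K" "\<And>x. x \<in> D \<Longrightarrow> x \<notin> K \<Longrightarrow> g x = 0" "K \<subseteq> D"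
    and "\<And>x. x \<in> D \<Longrightarrow> g differentiable (at x)"
  shows "(\<lambda>x. if x \<in> D then g x else 0) differentiable (at x)"
proof (cases "x \<in> D")
  case True
  then obtain g' where "(g has_derivative g') (at x)" using assms(5) by (auto simp: differentiable_def)
  then have "((\<lambda>x. if x \<in> D then g x else 0) has_derivative g') (at x)"
    by (rule has_derivative_transform_within_open[OF _ assms(1) True]) auto
  then show ?thesis by (auto simp: differentiable_def)
next
  case False
  have "((\<lambda>x. if x \<in> D then g x else 0) has_derivative (\<lambda>_. 0)) (at x)"
    using assms False
    by (intro has_derivative_transform_within_open[OF has_derivative_const[of 0], of "- K"]) (auto simp: open_Compl)
  then show ?thesis by (auto simp: differentiable_def)
qed

lemma DERIV_line_extend_0:
  fixes g :: "'a::real_normed_vector \<Rightarrow> real"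
  assumes "open D" "closed K" "\<And>x. x \<in> D \<Longrightarrow> x \<notin> K \<Longrightarrow> g x = 0" "K \<subseteq> D"
    and "\<And>x. x \<in> D \<Longrightarrow> ((\<lambda>t. g (x + t *\<^sub>R v)) has_real_derivative p x) (at 0)"
  shows "((\<lambda>t. if x + t *\<^sub>R v \<in> D then g (x + t *\<^sub>R v) else 0) has_real_derivative
     (if x \<in> D then p x else 0)) (at 0)"
proof (cases "x \<in> D")
  case True
  from eventually_line_in_open[OF assms(1) True, of v]
  have "\<forall>\<^sub>F t in nhds 0. (if x + t *\<^sub>R v \<in> D then g (x + t *\<^sub>R v) else 0) = g (x + t *\<^sub>R v)"
    by eventually_elim simp
  then show ?thesis using True assms(5) by (subst DERIV_cong_ev[OF refl _ refl]) auto
next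
  case False
  then have "\<forall>\<^sub>F t in nhds 0. x + t *\<^sub>R v \<in> - K"
    using assms by (intro eventually_line_in_open) (auto simp: open_Compl)
  then have "\<forall>\<^sub>F t in nhds 0. (if x + t *\<^sub>R v \<in> D then g (x + t *\<^sub>R v) else 0) = 0"
    by eventually_elim (use assms(3) in auto)
  then show ?thesis using False by (subst DERIV_cong_ev[OF refl _ refl]) auto
qed

text \<open>Testing the stability inequality with \<open>\<phi> = cutoff e \<circ> w\<close>, extended by \<open>0\<close>, and the
  differential inequality with \<open>cutoff_energy e \<circ> w\<close> gives the same Dirichlet energy, since
  \<open>cutoff_energy e\<close> is the primitive of \<open>(cutoff_deriv e)\<^sup>2\<close>; what is left is the defect between
  \<open>w * cutoff_energy e w\<close> and \<open>(cutoff e w)\<^sup>2\<close>.\<close>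

lemma cutoff_test_inequality:
  fixes w V :: "real^'n \<Rightarrow> real"
  assumes S: "open S" "bounded S" and V: "continuous_on S V" "\<And>x. x \<in> S \<Longrightarrow> \<bar>V x\<bar> \<le> M" and M: "M \<ge> 0"
    and pos: "first_dirichlet_eigenvalue S V > 0"
    and D: "open D" "D \<subseteq> S" and w: "C2_on w D" "continuous_on (closure D) w"
    and bdry: "\<And>x. x \<in> frontier D \<Longrightarrow> w x \<le> 0"
    and sub: "\<And>x. x \<in> D \<Longrightarrow> w x > 0 \<Longrightarrow> - laplacian w x \<le> V x * w x"
    and W: "\<And>x. x \<in> D \<Longrightarrow> w x \<le> W" "W \<ge> 0"
    and e: "e > 0" and ne: "\<exists>x\<in>D. w x > e"
  defines "\<phi> \<equiv> \<lambda>x. if x \<in> D then cutoff e (w x) else 0"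
  shows "(\<lambda>x. (\<phi> x)\<^sup>2) integrable_on S"
    and "first_dirichlet_eigenvalue S V * integral S (\<lambda>x. (\<phi> x)\<^sup>2) \<le> M * (4 / 3 * e * W) * measure lebesgue S"
proof -
  define K where "K = {x \<in> closure D. e \<le> w x}"
  have "bounded D" using S(2) D(2) by (rule bounded_subset)
  then have cl: "compact (closure D)" by (simp add: compact_closure)
  have "closedin (top_of_set (closure D)) K"
    unfolding K_def using continuous_closedin_preimage[OF w(2), of "{e..}"]
    by (simp add: vimage_def Int_def)
  then have K: "compact K" using cl by (rule closedin_compact[rotated])
  \<comment> \<open>The sign of \<open>w\<close> on the boundary enters here: points of
    \<open>K\<close> have \<open>w\<close> at least \<open>e > 0\<close>, so \<open>K\<close> stays
    off the frontier and the support of \<open>\<phi>\<close>, which lies in \<open>K\<close>, is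
    compact in \<open>D\<close>.\<close>
  have KD: "K \<subseteq> D"
  proof
    fix x assume x: "x \<in> K"
    then have "x \<notin> frontier D" using bdry[of x] e by (force simp: K_def)
    then show "x \<in> D" using x D(1) by (auto simp: K_def frontier_def interior_open)
  qed
  have small: "w x \<le> e" if "x \<in> D" "x \<notin> K" for x
    using that closure_subset[of D] by (auto simp: K_def)
  note K_closed = compact_imp_closed[OF K]
  have cutoff_cont: "continuous_on A (cutoff e)" "continuous_on A (cutoff_energy e)" "continuous_on A (cutoff_deriv e)" for A
    by (rule DERIV_continuous_on[OF has_field_derivative_at_within[OF DERIV_cutoff[OF e]]]
        DERIV_continuous_on[OF has_field_derivative_at_within[OF DERIV_cutoff_energy[OF e]]]
        continuous_on_subset[OF continuous_cutoff_deriv[OF e] subset_UNIV])+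
  have cont: "continuous_on D (\<lambda>x. cutoff e (w x))" "continuous_on D (\<lambda>x. cutoff_energy e (w x))"
    "continuous_on D (\<lambda>x. cutoff_deriv e (w x))"
    by (rule continuous_on_compose2[OF cutoff_cont(1) C2_on_continuous(1)[OF w(1)]]
        continuous_on_compose2[OF cutoff_cont(2) C2_on_continuous(1)[OF w(1)]]
        continuous_on_compose2[OF cutoff_cont(3) C2_on_continuous(1)[OF w(1)]], rule subset_UNIV)+
  note cut0 = cutoff_eq_0[OF e] cutoff_deriv_eq_0[OF e] cutoff_energy_eq_0[OF e]
  have wline: "((\<lambda>t. w (x + t *\<^sub>R axis i 1)) has_real_derivative partial i w x) (at 0)"
    "((\<lambda>t. partial i w (x + t *\<^sub>R axis i 1)) has_real_derivative partial i (partial i w) x) (at 0)"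
    if "x \<in> D" for x i
    using DERIV_partial[of w x 0 i] DERIV_partial[of "partial i w" x 0 i] C2_onD(1)[OF w(1) D(1) that] C2_onD(2)[OF w(1) D(1) that, of i]
    by auto

  have dcut: "((\<lambda>x. cutoff e (w x)) differentiable (at x))" if "x \<in> D" for x
  proof -
    have "cutoff e differentiable (at (w x))"
      using DERIV_cutoff[OF e, of "w x"] real_differentiable_def by blast
    then show ?thesis using differentiable_chain_at[OF C2_onD(1)[OF w(1) D(1) that]] by (simp add: o_def)
  qed
  have pcut: "partial i (\<lambda>x. cutoff e (w x)) x = cutoff_deriv e (w x) * partial i w x" if "x \<in> D" for x i
    unfolding partial_def[of i "\<lambda>x. cutoff e (w x)"]
    using DERIV_chain2[of "cutoff e" _ "\<lambda>t. w (x + t *\<^sub>R axis i 1)", OF _ wline(1)[OF that]] DERIV_cutoff[OF e]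
    by (auto intro!: DERIV_imp_deriv)
  have p\<phi>: "partial i \<phi> x = (if x \<in> D then cutoff_deriv e (w x) * partial i w x else 0)" for i x
    unfolding \<phi>_def using pcut cut0 small by (subst partial_extend_0[OF D(1) K_closed _ KD]) auto
  have "\<phi> \<in> C1c S"
    unfolding C1c_def
  proof (intro CollectI conjI allI)
    show "\<phi> differentiable_on UNIV"
      unfolding \<phi>_def
      by (intro differentiable_at_imp_differentiable_on differentiable_extend_0[OF D(1) K_closed _ KD] dcut)
        (use cut0 small in auto)
    show "continuous_on UNIV (partial i \<phi>)" for i
      unfolding p\<phi>[abs_def]
      by (intro continuous_extend_0[OF D(1) K_closed KD] continuous_intros cont C2_on_continuous[OF w(1)])
        (use cut0 small in auto)
    have "x \<in> K" if "\<phi> x \<noteq> 0" for x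
      using that small[of x] cut0(1)[of "w x"] by (auto simp: \<phi>_def split: if_splits)
    then have "{x. \<phi> x \<noteq> 0} \<subseteq> K" by auto
    then have *: "closure {x. \<phi> x \<noteq> 0} \<subseteq> K" using K_closed by (rule closure_minimal)
    then show "closure {x. \<phi> x \<noteq> 0} \<subseteq> S" using KD D by auto
    show "compact (closure {x. \<phi> x \<noteq> 0})"
      using * K by (meson closed_closure closed_subset closedin_compact compact_imp_closed closed_Int_compact inf.absorb_iff1)
  qed
  moreover from ne obtain y where "y \<in> D" "w y > e" by blast
  then have "\<phi> y \<noteq> 0" using e by (simp add: \<phi>_def cutoff_def)
  then have "\<exists>x. \<phi> x \<noteq> 0" ..
  ultimately have ray: "first_dirichlet_eigenvalue S V * integral S (\<lambda>x. (\<phi> x)\<^sup>2) \<le> integral S (\<lambda>x. grad_sq \<phi> x - V x * (\<phi> x)\<^sup>2)"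
    and int\<phi>: "(\<lambda>x. (\<phi> x)\<^sup>2) integrable_on S"
    and intQ: "(\<lambda>x. grad_sq \<phi> x - V x * (\<phi> x)\<^sup>2) integrable_on S"
    using rayleigh_bound[OF S V M pos] by auto
  show "(\<lambda>x. (\<phi> x)\<^sup>2) integrable_on S" by (rule int\<phi>)

  \<comment> \<open>Summed over \<open>i\<close>, this is the divergence of
    \<open>cutoff_energy e (w x)\<close> times the gradient of \<open>w\<close>, extended by
    zero.\<close>
  define P where "P i x = (if x \<in> D then (cutoff_deriv e (w x))\<^sup>2 * (partial i w x)\<^sup>2
     + cutoff_energy e (w x) * partial i (partial i w) x else 0)" for i x
  obtain R where R: "\<And>x. x \<in> S \<Longrightarrow> norm x \<le> R" using S(2) by (auto simp: bounded_iff)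
  have "(P i has_integral 0) UNIV" for i
  proof (rule integral_line_derivative_eq_0)
    show "((\<lambda>t. if x + t *\<^sub>R axis i 1 \<in> D then
       cutoff_energy e (w (x + t *\<^sub>R axis i 1)) * partial i w (x + t *\<^sub>R axis i 1) else 0) has_real_derivative P i x) (at 0)" for x
      unfolding P_def
    proof (rule DERIV_line_extend_0[OF D(1) K_closed _ KD])
      fix x assume x: "x \<in> D"
      have "((\<lambda>t. cutoff_energy e (w (x + t *\<^sub>R axis i 1))) has_real_derivative (cutoff_deriv e (w x))\<^sup>2 * partial i w x) (at 0)"
        using DERIV_chain2[of "cutoff_energy e" _ "\<lambda>t. w (x + t *\<^sub>R axis i 1)", OF _ wline(1)[OF x]] DERIV_cutoff_energy[OF e]
        by auto
      from DERIV_mult[OF this wline(2)[OF x]]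
      show "((\<lambda>t. cutoff_energy e (w (x + t *\<^sub>R axis i 1)) * partial i w (x + t *\<^sub>R axis i 1)) has_real_derivative
        (cutoff_deriv e (w x))\<^sup>2 * (partial i w x)\<^sup>2 + cutoff_energy e (w x) * partial i (partial i w) x) (at 0)"
        by (simp add: power2_eq_square algebra_simps)
    qed (use cut0 small in auto)
    show "continuous_on UNIV (\<lambda>x. if x \<in> D then cutoff_energy e (w x) * partial i w x else 0)"
      by (intro continuous_extend_0[OF D(1) K_closed KD] continuous_intros cont C2_on_continuous[OF w(1)])
        (use cut0 small in auto)
    show "continuous_on UNIV (P i)"
      unfolding P_def
      by (intro continuous_extend_0[OF D(1) K_closed KD] continuous_intros cont C2_on_continuous[OF w(1)])
        (use cut0 small in auto)
    show "(if x \<in> D then cutoff_energy e (w x) * partial i w x else 0) = 0" "P i x = 0" if "norm x > R" for x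
      using R[of x] D(2) that by (auto simp: P_def)
  qed
  then have "((\<lambda>x. \<Sum>i\<in>UNIV. P i x) has_integral (\<Sum>i\<in>(UNIV::'n set). 0)) UNIV"
    by (intro has_integral_sum) auto
  moreover have "(\<lambda>x. \<Sum>i\<in>UNIV. P i x) = (\<lambda>x. if x \<in> S then \<Sum>i\<in>UNIV. P i x else 0)"
  proof
    fix x
    have "P i x = 0" if "x \<notin> S" for i using that D(2) by (auto simp: P_def)
    then show "(\<Sum>i\<in>UNIV. P i x) = (if x \<in> S then \<Sum>i\<in>UNIV. P i x else 0)" by auto
  qed
  ultimately have "((\<lambda>x. if x \<in> S then \<Sum>i\<in>UNIV. P i x else 0) has_integral (\<Sum>i\<in>(UNIV::'n set). 0)) UNIV"
    by (rule subst[rotated])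
  then have P: "((\<lambda>x. \<Sum>i\<in>UNIV. P i x) has_integral 0) S"
    unfolding has_integral_restrict_UNIV by simp

  \<comment> \<open>Subtracting the divergence, which has integral 0, cancels the Dirichlet energy
    pointwise. Where \<open>w\<close> is positive the differential inequality for \<open>w\<close>
    reduces the rest to \<open>V\<close> times the defect; elsewhere every term is 0.\<close>
  have pt: "grad_sq \<phi> x - V x * (\<phi> x)\<^sup>2 - (\<Sum>i\<in>UNIV. P i x) \<le> M * (4 / 3 * e * W)" if "x \<in> S" for x
  proof (cases "x \<in> D \<and> w x > 0")
    case False
    then have "grad_sq \<phi> x - V x * (\<phi> x)\<^sup>2 - (\<Sum>i\<in>UNIV. P i x) = 0"
      unfolding grad_sq_def p\<phi> P_def using cut0[of "w x"] e by (auto simp: \<phi>_def)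
    then show ?thesis using M W e by simp
  next
    case True
    then have x: "x \<in> D" "w x > 0" by auto
    have "grad_sq \<phi> x = (\<Sum>i\<in>UNIV. (cutoff_deriv e (w x))\<^sup>2 * (partial i w x)\<^sup>2)"
      using x by (simp add: grad_sq_def p\<phi> power_mult_distrib)
    moreover have "(\<Sum>i\<in>UNIV. P i x) = (\<Sum>i\<in>UNIV. (cutoff_deriv e (w x))\<^sup>2 * (partial i w x)\<^sup>2)
        + cutoff_energy e (w x) * laplacian w x"
      using x by (simp add: P_def sum.distrib laplacian_def sum_distrib_left)
    moreover have "cutoff_energy e (w x) * (- laplacian w x) \<le> cutoff_energy e (w x) * (V x * w x)"
      using sub[OF x] cutoff_energy_nonneg[OF e] by (rule mult_left_mono)
    ultimately have "grad_sq \<phi> x - V x * (\<phi> x)\<^sup>2 - (\<Sum>i\<in>UNIV. P i x)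
        \<le> V x * (w x * cutoff_energy e (w x) - (cutoff e (w x))\<^sup>2)"
      using x by (simp add: \<phi>_def algebra_simps)
    also have "\<dots> \<le> \<bar>V x\<bar> * \<bar>w x * cutoff_energy e (w x) - (cutoff e (w x))\<^sup>2\<bar>"
      by (metis abs_ge_self abs_mult)
    also have "\<dots> \<le> M * (4 / 3 * e * w x)"
      using V(2)[OF that] cutoff_defect[OF e, of "w x"] x M by (intro mult_mono) auto
    also have "\<dots> \<le> M * (4 / 3 * e * W)"
      using W(1)[OF x(1)] M e by (intro mult_left_mono) auto
    finally show ?thesis .
  qed
  have Sm: "S \<in> lmeasurable" using S by (simp add: lmeasurable_open)
  have "integral S (\<lambda>x. grad_sq \<phi> x - V x * (\<phi> x)\<^sup>2)
      = integral S (\<lambda>x. grad_sq \<phi> x - V x * (\<phi> x)\<^sup>2 - (\<Sum>i\<in>UNIV. P i x))"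
    using integral_diff[OF intQ has_integral_integrable[OF P]] integral_unique[OF P] by simp
  also have "\<dots> \<le> integral S (\<lambda>x. M * (4 / 3 * e * W) * 1)"
    using pt integrable_on_const[OF Sm, of "M * (4 / 3 * e * W) * 1"] integrable_diff[OF intQ has_integral_integrable[OF P]]
    by (intro integral_le) auto
  also have "\<dots> = M * (4 / 3 * e * W) * measure lebesgue S"
    unfolding integral_mult_right by (subst lmeasure_integral[OF Sm]) simp
  finally show "first_dirichlet_eigenvalue S V * integral S (\<lambda>x. (\<phi> x)\<^sup>2) \<le> M * (4 / 3 * e * W) * measure lebesgue S"
    using ray by linarith
qed

text \<open>If \<open>w\<close> were positive somewhere, the test functions would keep a fixed
  amount of mass near that point for all small \<open>e\<close>, while the test inequality forces
  their mass to be of order \<open>e\<close>.\<close>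

lemma stable_maximum_principle:
  fixes w V :: "real^'n \<Rightarrow> real"
  assumes S: "open S" "bounded S" and V: "continuous_on S V" "\<And>x. x \<in> S \<Longrightarrow> \<bar>V x\<bar> \<le> M"
    and pos: "first_dirichlet_eigenvalue S V > 0"
    and D: "open D" "D \<subseteq> S" and w: "C2_on w D" "continuous_on (closure D) w"
    and bdry: "\<And>x. x \<in> frontier D \<Longrightarrow> w x \<le> 0"
    and sub: "\<And>x. x \<in> D \<Longrightarrow> w x > 0 \<Longrightarrow> - laplacian w x \<le> V x * w x"
    and "x \<in> D"
  shows "w x \<le> 0"
proof (rule ccontr)
  assume "\<not> w x \<le> 0"
  \<comment> \<open>With \<open>e\<close> at most \<open>\<eta>\<close> and a ball on which
    \<open>w\<close> exceeds 3/2 \<open>\<eta>\<close>, the excess \<open>w y - e\<close> is at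
    least \<open>\<eta> / 2\<close>, uniformly in \<open>e\<close>.\<close>
  define \<eta> where "\<eta> = w x / 2"
  have \<eta>: "\<eta> > 0" "w x = 2 * \<eta>" using \<open>\<not> w x \<le> 0\<close> by (auto simp: \<eta>_def)
  have M: "M \<ge> 0" using V(2)[of x] \<open>x \<in> D\<close> D(2) by auto
  have "bounded D" using S(2) D(2) by (rule bounded_subset)
  then have "compact (w ` closure D)" using w(2) by (intro compact_continuous_image) (simp_all add: compact_closure)
  then obtain W0 where W0: "\<And>y. y \<in> closure D \<Longrightarrow> norm (w y) \<le> W0"
    by (metis compact_imp_bounded bounded_iff imageI)
  define W where "W = max W0 1"
  have W: "\<And>y. y \<in> D \<Longrightarrow> w y \<le> W" "W \<ge> 0" "W > 0"
    using W0 closure_subset[of D] by (fastforce simp: W_def)+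
  have "open {y \<in> D. w y > 3 / 2 * \<eta>}"
    using continuous_open_preimage[OF C2_on_continuous(1)[OF w(1)] D(1), of "{3 / 2 * \<eta><..}"]
    by (simp add: vimage_def Int_def)
  moreover have "x \<in> {y \<in> D. w y > 3 / 2 * \<eta>}" using \<open>x \<in> D\<close> \<eta> by auto
  ultimately obtain r where r: "r > 0" "ball x r \<subseteq> {y \<in> D. w y > 3 / 2 * \<eta>}"
    by (meson open_contains_ball)
  \<comment> \<open>A lower bound for the squared test function on the ball: there it is (w - e)^2 /
    w before squaring, with numerator at least (\<open>\<eta>\<close> / 2)^2 and denominator at most
    \<open>W\<close>.\<close>
  define c where "c = ((\<eta> / 2)\<^sup>2 / W)\<^sup>2"
  define \<mu> where "\<mu> = first_dirichlet_eigenvalue S V"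
  define a where "a = \<mu> * (c * measure lebesgue (ball x r))"
  define b where "b = M * (4 / 3 * W) * measure lebesgue S"
  have "c > 0" using \<eta> W by (simp add: c_def)
  then have a: "a > 0" using pos r(1) by (simp add: a_def \<mu>_def content_ball_pos)
  have b: "b \<ge> 0" using M W by (simp add: b_def)
  have key: "a \<le> b * e" if e: "0 < e" "e \<le> \<eta>" for e
  proof -
    define \<phi> where "\<phi> = (\<lambda>x. if x \<in> D then cutoff e (w x) else 0)"
    have ne: "\<exists>x\<in>D. w x > e" using \<open>x \<in> D\<close> e \<eta> by (intro bexI[of _ x]) auto
    note test' = cutoff_test_inequality[OF S V M pos D w bdry sub W(1,2) e(1) ne]
    have test: "(\<lambda>x. (\<phi> x)\<^sup>2) integrable_on S"
      "\<mu> * integral S (\<lambda>x. (\<phi> x)\<^sup>2) \<le> M * (4 / 3 * e * W) * measure lebesgue S"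
      unfolding \<phi>_def \<mu>_def by (rule test'; assumption)+
    have "c \<le> (\<phi> y)\<^sup>2" if "y \<in> ball x r" for y
    proof -
      have y: "y \<in> D" "w y > 3 / 2 * \<eta>" "w y \<le> W" using that r(2) W by auto
      have "(\<eta> / 2)\<^sup>2 / W \<le> (w y - e)\<^sup>2 / w y"
        using y e \<eta> by (intro frac_le power_mono) auto
      also have "\<dots> = \<phi> y" using y e \<eta> by (simp add: \<phi>_def cutoff_def)
      finally show ?thesis unfolding c_def using W by (intro power_mono) auto
    qed
    have Sball: "S \<inter> ball x r = ball x r" "ball x r \<inter> S = ball x r" using r(2) D(2) by auto
    have "c * measure lebesgue (ball x r) = integral (ball x r) (\<lambda>y. c * 1)"
      unfolding integral_mult_right by (subst lmeasure_integral) simp_all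
    also have "\<dots> = integral S (\<lambda>y. if y \<in> ball x r then c else 0)"
      by (subst integral_restrict_Int) (simp add: Sball)
    also have "\<dots> \<le> integral S (\<lambda>y. (\<phi> y)\<^sup>2)"
    proof (rule integral_le)
      have "(\<lambda>y. c) integrable_on ball x r" by (rule integrable_on_const) simp
      then show "(\<lambda>y. if y \<in> ball x r then c else 0) integrable_on S"
        by (subst integrable_restrict_Int) (simp add: Sball)
    qed (use test(1) \<open>\<And>y. y \<in> ball x r \<Longrightarrow> c \<le> (\<phi> y)\<^sup>2\<close> in auto)
    finally have "a \<le> \<mu> * integral S (\<lambda>y. (\<phi> y)\<^sup>2)"
      unfolding a_def using pos by (intro mult_left_mono) (auto simp: \<mu>_def)
    also have "\<dots> \<le> b * e" using test(2) by (simp add: b_def algebra_simps)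
    finally show ?thesis .
  qed
  \<comment> \<open>Small enough that \<open>b * e\<close> is at most half of \<open>a\<close>; the
    summand 1 covers the case \<open>b = 0\<close>.\<close>
  define e where "e = min \<eta> (a / (2 * (b + 1)))"
  have "0 < e" "e \<le> \<eta>" using a b \<eta> by (auto simp: e_def)
  then have "a \<le> b * e" by (rule key)
  also have "\<dots> \<le> b * (a / (2 * (b + 1)))" using b by (intro mult_left_mono) (auto simp: e_def)
  also have "\<dots> < a" using a b by (simp add: divide_simps)
  finally show False by simp
qed

section \<open>Rigid motions of the domain\<close>

lemma differentiable_cong_open:
  assumes "open D" "x \<in> D" "\<And>y. y \<in> D \<Longrightarrow> f y = g y" "g differentiable (at x)"
  shows "f differentiable (at x)"
proof -
  obtain g' where "(g has_derivative g') (at x)" using assms(4) by (auto simp: differentiable_def)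
  then have "(f has_derivative g') (at x)"
    by (rule has_derivative_transform_within_open[OF _ assms(1,2)]) (simp add: assms(3))
  then show ?thesis by (auto simp: differentiable_def)
qed

lemma partial_diff:
  assumes "u differentiable (at x)" "v differentiable (at x)"
  shows "partial i (\<lambda>x. u x - v x) x = partial i u x - partial i v x"
  unfolding partial_def[of i "\<lambda>x. u x - v x"]
  using DERIV_diff[OF DERIV_partial[of u x 0 i] DERIV_partial[of v x 0 i]] assms
  by (auto intro!: DERIV_imp_deriv)

lemma C2_on_subset: "C2_on u S \<Longrightarrow> T \<subseteq> S \<Longrightarrow> C2_on u T"
  unfolding C2_on_def by (meson continuous_on_subset differentiable_on_subset)

lemma C2_on_diff:
  assumes u: "C2_on u D" and v: "C2_on v D" and D: "open D"
  shows "C2_on (\<lambda>x. u x - v x) D"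
    and "x \<in> D \<Longrightarrow> laplacian (\<lambda>x. u x - v x) x = laplacian u x - laplacian v x"
proof -
  note du = C2_onD[OF u D] and dv = C2_onD[OF v D]
  have p: "partial i (\<lambda>x. u x - v x) x = partial i u x - partial i v x" if "x \<in> D" for i x
    using du(1) dv(1) that by (intro partial_diff)
  have pp: "partial j (partial i (\<lambda>x. u x - v x)) x = partial j (partial i u) x - partial j (partial i v) x"
    if "x \<in> D" for i j x
  proof -
    have "partial j (partial i (\<lambda>x. u x - v x)) x = partial j (\<lambda>x. partial i u x - partial i v x) x"
      by (rule partial_cong_open[OF D that p])
    also have "\<dots> = partial j (partial i u) x - partial j (partial i v) x"
      using du(2) dv(2) that by (intro partial_diff)
    finally show ?thesis .
  qed
  show "C2_on (\<lambda>x. u x - v x) D"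
    unfolding C2_on_def differentiable_on_eq_differentiable_at[OF D]
  proof (intro conjI allI ballI)
    fix x assume x: "x \<in> D"
    show "(\<lambda>x. u x - v x) differentiable (at x)" using du(1) dv(1) x by simp
    show "partial i (\<lambda>x. u x - v x) differentiable (at x)" for i
      using du(2) dv(2) x by (intro differentiable_cong_open[OF D x p]) auto
  next
    show "continuous_on D (partial j (partial i (\<lambda>x. u x - v x)))" for i j
      using continuous_on_diff[OF C2_on_continuous(3)[OF u] C2_on_continuous(3)[OF v]] pp
      by (simp cong: continuous_on_cong)
  qed
  show "x \<in> D \<Longrightarrow> laplacian (\<lambda>x. u x - v x) x = laplacian u x - laplacian v x"
    by (simp add: laplacian_def pp sum_subtractf)
qed

text \<open>The rows of an orthogonal matrix are orthonormal. This collapses the double sum of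
  second derivatives in the chain rule to its trace, whence the Laplacian commutes with rigid
  motions.\<close>

lemma orthogonal_transformation_axis_sum:
  fixes T :: "real^'n \<Rightarrow> real^'n"
  assumes "orthogonal_transformation T"
  shows "(\<Sum>i\<in>UNIV. T (axis i 1) $ a * T (axis i 1) $ b) = (if a = b then 1 else 0)"
proof -
  have "matrix T ** transpose (matrix T) = mat 1"
    using assms by (simp add: orthogonal_transformation_matrix orthogonal_matrix_def)
  then have "(matrix T ** transpose (matrix T)) $ a $ b = mat 1 $ a $ b" by simp
  then show ?thesis
    by (simp add: matrix_matrix_mult_def transpose_def matrix_def mat_def)
qed

lemma C2_on_compose_rigid:
  fixes u :: "real^'n \<Rightarrow> real" and T :: "real^'n \<Rightarrow> real^'n"
  assumes u: "C2_on u S" and S: "open S" and D: "open D"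
    and T: "orthogonal_transformation T" and A: "\<And>x. x \<in> D \<Longrightarrow> T x + b \<in> S"
  shows "C2_on (\<lambda>x. u (T x + b)) D"
    and "x \<in> D \<Longrightarrow> laplacian (\<lambda>x. u (T x + b)) x = laplacian u (T x + b)"
proof -
  have dT: "((\<lambda>x. T x + b) has_derivative T) (at x)" for x
    using T orthogonal_transformation_linear[OF T] 
    by (intro has_derivative_add[where g' = "\<lambda>_. 0", simplified] bounded_linear.has_derivative[of T, OF _ has_derivative_ident])
      (auto simp: linear_linear)
  have comp: "((\<lambda>x. v (T x + b)) has_derivative (\<lambda>h. \<Sum>a\<in>UNIV. T h $ a * partial a v (T x + b))) (at x)"
    if "v differentiable (at (T x + b))" for v x
    using diff_chain_at[OF dT has_derivative_partial[OF that]] by (simp add: o_def)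
  note du = C2_onD[OF u S A]
  have p: "partial i (\<lambda>x. u (T x + b)) x = (\<Sum>a\<in>UNIV. T (axis i 1) $ a * partial a u (T x + b))"
    if "x \<in> D" for i x
    by (rule partial_eqI[OF comp[OF du(1)[OF that]]])
  have dp: "((\<lambda>x. \<Sum>a\<in>UNIV. T (axis i 1) $ a * partial a u (T x + b)) has_derivative
      (\<lambda>h. \<Sum>a\<in>UNIV. T (axis i 1) $ a * (\<Sum>c\<in>UNIV. T h $ c * partial c (partial a u) (T x + b)))) (at x)"
    if "x \<in> D" for i x
    by (intro has_derivative_sum has_derivative_mult_right comp du(2) that)
  have pp: "partial j (partial i (\<lambda>x. u (T x + b))) x
      = (\<Sum>a\<in>UNIV. T (axis i 1) $ a * (\<Sum>c\<in>UNIV. T (axis j 1) $ c * partial c (partial a u) (T x + b)))"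
    if "x \<in> D" for i j x
  proof -
    have "partial j (partial i (\<lambda>x. u (T x + b))) x
        = partial j (\<lambda>x. \<Sum>a\<in>UNIV. T (axis i 1) $ a * partial a u (T x + b)) x"
      by (rule partial_cong_open[OF D that p])
    also note partial_eqI[OF dp[OF that]]
    finally show ?thesis .
  qed
  have cA: "continuous_on D (\<lambda>x. T x + b)"
    using dT by (meson continuous_at_imp_continuous_on has_derivative_continuous)
  show "C2_on (\<lambda>x. u (T x + b)) D"
    unfolding C2_on_def differentiable_on_eq_differentiable_at[OF D]
  proof (intro conjI allI ballI)
    fix x assume x: "x \<in> D"
    show "(\<lambda>x. u (T x + b)) differentiable (at x)"
      using comp[OF du(1)[OF x]] by (auto simp: differentiable_def)
    show "partial i (\<lambda>x. u (T x + b)) differentiable (at x)" for i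
      by (rule differentiable_cong_open[OF D x p]) (use dp[OF x] in \<open>auto simp: differentiable_def\<close>)
  next
    have "continuous_on D (\<lambda>x. partial c (partial a u) (T x + b))" for a c
      using continuous_on_compose2[OF C2_on_continuous(3)[OF u] cA] A by blast
    then have "continuous_on D (\<lambda>x. \<Sum>a\<in>UNIV. T (axis i 1) $ a * (\<Sum>c\<in>UNIV. T (axis j 1) $ c * partial c (partial a u) (T x + b)))" for i j
      by (intro continuous_intros)
    then show "continuous_on D (partial j (partial i (\<lambda>x. u (T x + b))))" for i j
      using pp by (simp cong: continuous_on_cong)
  qed
  show "laplacian (\<lambda>x. u (T x + b)) x = laplacian u (T x + b)" if x: "x \<in> D"
  proof -
    have "laplacian (\<lambda>x. u (T x + b)) x = (\<Sum>i\<in>UNIV. \<Sum>a\<in>UNIV. \<Sum>c\<in>UNIV.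
        partial c (partial a u) (T x + b) * (T (axis i 1) $ a * T (axis i 1) $ c))"
      by (simp add: laplacian_def pp[OF x] sum_distrib_left mult_ac)
    also have "\<dots> = (\<Sum>a\<in>UNIV. \<Sum>c\<in>UNIV. \<Sum>i\<in>UNIV.
        partial c (partial a u) (T x + b) * (T (axis i 1) $ a * T (axis i 1) $ c))"
      by (subst sum.swap) (intro sum.cong refl sum.swap)
    also have "\<dots> = (\<Sum>a\<in>UNIV. \<Sum>c\<in>UNIV. if a = c then partial c (partial a u) (T x + b) else 0)"
      unfolding sum_distrib_left[symmetric] orthogonal_transformation_axis_sum[OF T]
      by (intro sum.cong) auto
    also have "\<dots> = laplacian u (T x + b)" by (simp add: laplacian_def)
    finally show ?thesis .
  qed
qed

section \<open>A barrier on a tube\<close>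

text \<open>If \<open>c\<close> were positive, \<open>G'\<close> would pass through 0 increasingly,
  so \<open>G\<close> would grow just to the right of 0. Differentiability of \<open>G'\<close> is
  required at 0 alone, which is all that \<open>C2_on\<close> yields directly along a line.\<close>

lemma second_derivative_nonpos_at_max:
  fixes G :: "real \<Rightarrow> real"
  assumes d: "d > 0" and G: "\<And>s. \<bar>s\<bar> < d \<Longrightarrow> (G has_real_derivative G' s) (at s)"
    and G': "(G' has_real_derivative c) (at 0)" and max: "\<And>s. \<bar>s\<bar> < d \<Longrightarrow> G s \<le> G 0"
  shows "c \<le> 0"
proof (rule ccontr)
  assume "\<not> c \<le> 0"
  have "G' 0 = 0"
    by (rule DERIV_local_max[OF G[of 0] d]) (use d max in \<open>auto simp: abs_minus_commute\<close>)
  obtain r where r: "r > 0" "\<And>h. 0 < h \<Longrightarrow> h < r \<Longrightarrow> G' 0 < G' (0 + h)"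
    using DERIV_pos_inc_right[OF G'] \<open>\<not> c \<le> 0\<close> by auto
  define s where "s = min d r / 2"
  have s: "0 < s" "s < d" "s < r" using d r(1) by (auto simp: s_def)
  obtain z where z: "0 < z" "z < s" "G s - G 0 = (s - 0) * G' z"
    using MVT2[of 0 s G G'] G s by force
  have "G' z > 0" using r(2)[of z] z s \<open>G' 0 = 0\<close> by auto
  then have "G s > G 0" using z(3) s(1) by (simp add: field_simps)
  then show False using max[of s] s by simp
qed

text \<open>A solid cylinder with base centre \<open>x0\<close>, its axis in direction
  \<open>i\<close>. In the application the base lies in the mirror plane, where \<open>w\<close> is
  0, the top lies where \<open>w\<close> is negative, and on the lateral surface only
  \<open>w\<close> at most 0 is known.\<close>

locale tube =
  fixes x0 :: "real^'n" and i :: 'n and L \<rho> :: real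
  assumes L: "L > 0" and \<rho>: "\<rho> > 0"
begin

definition height :: "real^'n \<Rightarrow> real" where "height x = (x - x0) $ i"

definition radius_sq :: "real^'n \<Rightarrow> real" where
  "radius_sq x = (x - x0) \<bullet> (x - x0) - (height x)\<^sup>2"

definition closed_tube :: "(real^'n) set" where
  "closed_tube = {x. 0 \<le> height x \<and> height x \<le> L \<and> radius_sq x \<le> \<rho>\<^sup>2}"

definition open_tube :: "(real^'n) set" where
  "open_tube = {x. 0 < height x \<and> height x < L \<and> radius_sq x < \<rho>\<^sup>2}"

text \<open>The first factor vanishes on the base with positive slope, as a Hopf argument wants; the
  second vanishes on the lateral surface. It is squared because the transversal Laplacian of the
  square is positive near that surface, whereas that of \<open>\<rho>\<^sup>2 - radius_sq x\<close>
  itself is never positive.\<close>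

definition barrier :: "real \<Rightarrow> real^'n \<Rightarrow> real" where
  "barrier \<alpha> x = (exp (\<alpha> * height x) - 1) * (\<rho>\<^sup>2 - radius_sq x)\<^sup>2"

lemma continuous_height: "continuous_on A height"
  unfolding height_def by (intro continuous_intros)

lemma continuous_radius_sq: "continuous_on A radius_sq"
  unfolding radius_sq_def by (intro continuous_intros continuous_height)

lemma continuous_barrier: "continuous_on A (barrier \<alpha>)"
  unfolding barrier_def by (intro continuous_intros continuous_height continuous_radius_sq)

lemma radius_sq_dist: "radius_sq x = (dist x (x0 + height x *\<^sub>R axis i 1))\<^sup>2"
proof -
  have "(dist x (x0 + height x *\<^sub>R axis i 1))\<^sup>2 = ((x - x0) - height x *\<^sub>R axis i 1) \<bullet> ((x - x0) - height x *\<^sub>R axis i 1)"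
    by (simp add: dist_norm power2_norm_eq_inner algebra_simps)
  also have "\<dots> = radius_sq x"
    unfolding inner_diff_left inner_diff_right
    by (simp add: radius_sq_def height_def inner_axis inner_axis' power2_eq_square algebra_simps)
  finally show ?thesis ..
qed

lemma radius_sq_sum: "radius_sq x = (\<Sum>j\<in>UNIV - {i}. ((x - x0) $ j)\<^sup>2)"
proof -
  have "(x - x0) \<bullet> (x - x0) = (\<Sum>j\<in>UNIV. ((x - x0) $ j)\<^sup>2)"
    by (simp add: inner_vec_def power2_eq_square)
  also have "\<dots> = (height x)\<^sup>2 + (\<Sum>j\<in>UNIV - {i}. ((x - x0) $ j)\<^sup>2)"
    by (simp add: sum.remove[of UNIV i] height_def)
  finally show ?thesis by (simp add: radius_sq_def)
qed

lemma open_open_tube: "open open_tube"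
  unfolding open_tube_def
  by (intro open_Collect_conj open_Collect_less continuous_height continuous_radius_sq continuous_intros)

lemma compact_closed_tube: "compact closed_tube"
proof (rule compact_eq_bounded_closed[THEN iffD2, OF conjI])
  show "closed closed_tube"
    unfolding closed_tube_def
    by (intro closed_Collect_conj closed_Collect_le continuous_height continuous_radius_sq continuous_intros)
  have "dist x0 x \<le> L + \<rho>" if "x \<in> closed_tube" for x
  proof -
    have x: "0 \<le> height x" "height x \<le> L" "radius_sq x \<le> \<rho>\<^sup>2" using that by (auto simp: closed_tube_def)
    have "dist x (x0 + height x *\<^sub>R axis i 1) \<le> \<rho>"
      using x(3) \<rho> unfolding radius_sq_dist by (simp add: power2_le_iff_abs_le)
    moreover have "dist x0 (x0 + height x *\<^sub>R axis i 1) \<le> L"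
      using x(1,2) by (simp add: dist_norm)
    ultimately show ?thesis
      using dist_triangle2[of x0 x "x0 + height x *\<^sub>R axis i 1"] by linarith
  qed
  then show "bounded closed_tube" unfolding bounded_def by blast
qed

lemma height_line: "height (x + s *\<^sub>R axis j 1) = height x + (if j = i then s else 0)"
  by (simp add: height_def axis_def)

lemma radius_sq_line:
  "radius_sq (x + s *\<^sub>R axis j 1) = radius_sq x + (if j = i then 0 else 2 * s * (x - x0) $ j + s\<^sup>2)"
proof -
  define z where "z = x - x0"
  have "(z + s *\<^sub>R axis j 1) \<bullet> (z + s *\<^sub>R axis j 1) = z \<bullet> z + 2 * s * (z \<bullet> axis j 1) + s\<^sup>2 * (axis j 1 \<bullet> (axis j 1 :: real^'n))"
    by (simp add: inner_add_left inner_add_right inner_commute power2_eq_square)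
  also have "z \<bullet> axis j 1 = z $ j" by (simp add: inner_axis)
  also have "axis j 1 \<bullet> (axis j 1 :: real^'n) = 1" by (simp add: inner_axis)
  finally have "(z + s *\<^sub>R axis j 1) \<bullet> (z + s *\<^sub>R axis j 1) = z \<bullet> z + 2 * s * z $ j + s\<^sup>2" by simp
  moreover have "x + s *\<^sub>R axis j 1 - x0 = z + s *\<^sub>R axis j 1" by (simp add: z_def)
  ultimately have eq: "(x + s *\<^sub>R axis j 1 - x0) \<bullet> (x + s *\<^sub>R axis j 1 - x0)
      = (x - x0) \<bullet> (x - x0) + 2 * s * (x - x0) $ j + s\<^sup>2"
    by (simp only: z_def)
  show ?thesis
    unfolding radius_sq_def height_line eq by (simp add: height_def power2_sum)
qed

text \<open>The pure second derivative of \<open>barrier\<close> in direction \<open>j\<close>, as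
  verified by \<open>barrier_line_derivatives\<close>.\<close>

definition barrier2 :: "real \<Rightarrow> 'n \<Rightarrow> real^'n \<Rightarrow> real" where
  "barrier2 \<alpha> j x = (if j = i then \<alpha>\<^sup>2 * exp (\<alpha> * height x) * (\<rho>\<^sup>2 - radius_sq x)\<^sup>2
     else (exp (\<alpha> * height x) - 1) * (8 * ((x - x0) $ j)\<^sup>2 - 4 * (\<rho>\<^sup>2 - radius_sq x)))"

lemma barrier_line_derivatives:
  obtains B where "\<And>s. ((\<lambda>s. barrier \<alpha> (x + s *\<^sub>R axis j 1)) has_real_derivative B s) (at s)"
    and "(B has_real_derivative barrier2 \<alpha> j x) (at 0)"
proof (cases "j = i")
  case True
  show thesis
  proof
    show "((\<lambda>s. barrier \<alpha> (x + s *\<^sub>R axis j 1)) has_real_derivative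
        \<alpha> * exp (\<alpha> * (height x + s)) * (\<rho>\<^sup>2 - radius_sq x)\<^sup>2) (at s)" for s
      using True by (auto simp: barrier_def height_line radius_sq_line intro!: derivative_eq_intros)
    show "((\<lambda>s. \<alpha> * exp (\<alpha> * (height x + s)) * (\<rho>\<^sup>2 - radius_sq x)\<^sup>2) has_real_derivative barrier2 \<alpha> j x) (at 0)"
      using True by (auto simp: barrier2_def power2_eq_square intro!: derivative_eq_intros)
  qed
next
  case False
  let ?z = "(x - x0) $ j"
  show thesis
  proof
    show "((\<lambda>s. barrier \<alpha> (x + s *\<^sub>R axis j 1)) has_real_derivative
        (exp (\<alpha> * height x) - 1) * (2 * (\<rho>\<^sup>2 - radius_sq x - 2 * s * ?z - s\<^sup>2) * (- 2 * ?z - 2 * s))) (at s)" for s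
      unfolding barrier_def height_line radius_sq_line if_not_P[OF False]
      by (rule derivative_eq_intros refl | simp add: algebra_simps)+
    show "((\<lambda>s. (exp (\<alpha> * height x) - 1) * (2 * (\<rho>\<^sup>2 - radius_sq x - 2 * s * ?z - s\<^sup>2) * (- 2 * ?z - 2 * s)))
        has_real_derivative barrier2 \<alpha> j x) (at 0)"
      unfolding barrier2_def if_not_P[OF False]
      by (rule derivative_eq_intros refl | simp add: algebra_simps power2_eq_square)+
  qed
qed

end

section \<open>The barrier as a strict subsolution, comparison and boundary slope\<close>

context tube
begin

text \<open>The square of the exponent must pay for two things: \<open>M\<close> for the zero order
  term, and the other summand for completing a square in
  \<open>\<rho>\<^sup>2 - radius_sq x\<close>, where the linear coefficient is 4 (n + 1).\<close>

definition rate :: "real \<Rightarrow> real" where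
  "rate M = sqrt (M + (real CARD('n) + 1)\<^sup>2 / \<rho>\<^sup>2)"

lemma rate_pos: "M \<ge> 0 \<Longrightarrow> rate M > 0"
  using \<rho> by (simp add: rate_def add_nonneg_pos)

lemma barrier_subsolution:
  assumes M: "M \<ge> 0" and x: "x \<in> open_tube"
  shows "M * barrier (rate M) x < (\<Sum>j\<in>UNIV. barrier2 (rate M) j x)"
proof -
  define \<alpha> where "\<alpha> = rate M"
  define E where "E = exp (\<alpha> * height x)"
  define s where "s = \<rho>\<^sup>2 - radius_sq x"
  define N where "N = real CARD('n)"
  have \<alpha>2: "\<alpha>\<^sup>2 = M + (N + 1)\<^sup>2 / \<rho>\<^sup>2"
    using M by (simp add: \<alpha>_def rate_def N_def)
  have E: "E > 1" using x rate_pos[OF M] by (simp add: E_def open_tube_def \<alpha>_def)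
  have sq: "radius_sq x = \<rho>\<^sup>2 - s" by (simp add: s_def)
  have "(\<Sum>j\<in>UNIV. barrier2 \<alpha> j x) = barrier2 \<alpha> i x + (\<Sum>j\<in>UNIV - {i}. barrier2 \<alpha> j x)"
    by (simp add: sum.remove[of UNIV i])
  also have "(\<Sum>j\<in>UNIV - {i}. barrier2 \<alpha> j x) = (\<Sum>j\<in>UNIV - {i}. (E - 1) * (8 * ((x - x0) $ j)\<^sup>2 - 4 * s))"
    by (intro sum.cong refl) (auto simp: barrier2_def E_def s_def)
  also have "\<dots> = (E - 1) * (8 * radius_sq x - 4 * (N - 1) * s)"
    unfolding sum_distrib_left[symmetric] sum_subtractf radius_sq_sum
    by (simp add: N_def card_Diff_singleton of_nat_diff)
  also have "barrier2 \<alpha> i x = \<alpha>\<^sup>2 * E * s\<^sup>2" by (simp add: barrier2_def E_def s_def)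
  finally have sum: "(\<Sum>j\<in>UNIV. barrier2 \<alpha> j x) = \<alpha>\<^sup>2 * E * s\<^sup>2 + (E - 1) * (8 * (\<rho>\<^sup>2 - s) - 4 * (N - 1) * s)"
    unfolding sq .
  \<comment> \<open>The linear terms -8 s and -4 (N - 1) s add up to -4 (N + 1) s, exactly the cross
    term of this square; of the constant 8 \<open>\<rho>\<^sup>2\<close>, half goes into the square
    and half remains as the strict surplus.\<close>
  have "0 < ((N + 1) * s / \<rho> - 2 * \<rho>)\<^sup>2 + 4 * \<rho>\<^sup>2" using \<rho> by (simp add: add_nonneg_pos)
  also have "\<dots> = (N + 1)\<^sup>2 / \<rho>\<^sup>2 * s\<^sup>2 + 8 * (\<rho>\<^sup>2 - s) - 4 * (N - 1) * s"
    using \<rho> by (simp add: power2_diff power_mult_distrib power_divide) (simp add: field_simps)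
  finally have "0 < (E - 1) * ((N + 1)\<^sup>2 / \<rho>\<^sup>2 * s\<^sup>2 + 8 * (\<rho>\<^sup>2 - s) - 4 * (N - 1) * s)"
    using E by simp
  also have "\<dots> = (E - 1) * (\<alpha>\<^sup>2 * s\<^sup>2) + (E - 1) * (8 * (\<rho>\<^sup>2 - s) - 4 * (N - 1) * s) - M * ((E - 1) * s\<^sup>2)"
    unfolding \<alpha>2 by (simp add: algebra_simps)
  \<comment> \<open>The axial term carries \<open>E\<close> instead of \<open>E - 1\<close>; the
    surplus \<open>\<alpha>\<^sup>2 * s\<^sup>2\<close> is nonnegative and is dropped.\<close>
  also have "\<dots> \<le> (\<Sum>j\<in>UNIV. barrier2 \<alpha> j x) - M * ((E - 1) * s\<^sup>2)"
    unfolding sum by (simp add: algebra_simps)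
  finally show ?thesis by (simp add: barrier_def E_def s_def \<alpha>_def)
qed

text \<open>A positive maximum of \<open>w\<close> plus a small multiple of the barrier can lie
  neither where the barrier vanishes nor on the top. At an interior maximum all pure second
  derivatives are nonpositive, yet their sum exceeds \<open>M\<close> times the positive
  maximum.\<close>

lemma barrier_comparison:
  assumes M: "M \<ge> 0" and wc: "continuous_on closed_tube w" and w: "C2_on w open_tube"
    and neg: "\<And>x. x \<in> closed_tube \<Longrightarrow> w x \<le> 0"
    and top: "\<And>x. x \<in> closed_tube \<Longrightarrow> height x = L \<Longrightarrow> w x < 0"
    and sub: "\<And>x. x \<in> open_tube \<Longrightarrow> M * w x \<le> laplacian w x"
  shows "\<exists>\<delta>>0. \<forall>x\<in>closed_tube. w x \<le> - \<delta> * barrier (rate M) x"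
proof -
  define \<alpha> where "\<alpha> = rate M"
  define F where "F = closed_tube \<inter> {x. height x = L}"
  have "closed {x. height x = L}"
    by (intro closed_Collect_eq continuous_height continuous_intros)
  then have "compact F" unfolding F_def using compact_closed_tube by (rule compact_Int_closed[rotated])
  moreover have "x0 + L *\<^sub>R axis i 1 \<in> F"
    using L \<rho> by (simp add: F_def closed_tube_def radius_sq_dist height_def)
  then have "F \<noteq> {}" by auto
  moreover have "continuous_on F w" using wc by (rule continuous_on_subset) (auto simp: F_def)
  ultimately obtain p where p: "p \<in> F" "\<And>x. x \<in> F \<Longrightarrow> w x \<le> w p"
    using continuous_attains_sup[of F w] by metis
  have wp: "w p < 0" using p(1) top by (simp add: F_def)
  \<comment> \<open>An upper bound for the barrier on the top, so that \<open>\<delta>\<close> times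
    the barrier is at most \<open>- w p\<close> there and cannot outweigh \<open>w\<close>.\<close>
  define c where "c = exp (\<alpha> * L) * (\<rho>\<^sup>2)\<^sup>2"
  have c: "c > 0" using \<rho> by (simp add: c_def)
  define \<delta> where "\<delta> = - w p / c"
  have \<delta>: "\<delta> > 0" "\<delta> * c = - w p" using wp c by (simp_all add: \<delta>_def divide_neg_pos)
  define g where "g x = w x + \<delta> * barrier \<alpha> x" for x
  have "continuous_on closed_tube g"
    unfolding g_def by (intro continuous_intros wc continuous_barrier)
  moreover have "x0 + L *\<^sub>R axis i 1 \<in> closed_tube" using \<open>x0 + L *\<^sub>R axis i 1 \<in> F\<close> by (simp add: F_def)
  then have "closed_tube \<noteq> {}" by auto
  ultimately obtain z where z: "z \<in> closed_tube" "\<And>x. x \<in> closed_tube \<Longrightarrow> g x \<le> g z"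
    using continuous_attains_sup[OF compact_closed_tube, of g] by metis
  have "g z \<le> 0"
  proof (rule ccontr)
    assume "\<not> g z \<le> 0"
    then have gz: "g z > 0" by simp
    \<comment> \<open>This excludes the base and the lateral surface at once: the barrier is 0
      there, and \<open>g\<close> equals \<open>w\<close>.\<close>
    then have hz: "barrier \<alpha> z \<noteq> 0" using neg[OF z(1)] by (auto simp: g_def)
    have "height z \<noteq> L"
    proof
      assume *: "height z = L"
      then have "w z \<le> w p" using p z(1) by (simp add: F_def)
      moreover have "barrier \<alpha> z \<le> c"
      proof -
        have "\<bar>\<rho>\<^sup>2 - radius_sq z\<bar> \<le> \<bar>\<rho>\<^sup>2\<bar>"
          using z(1) zero_le_power2[of "dist z (x0 + height z *\<^sub>R axis i 1)"]
          unfolding radius_sq_dist[symmetric] by (simp add: closed_tube_def)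
        then have "(\<rho>\<^sup>2 - radius_sq z)\<^sup>2 \<le> (\<rho>\<^sup>2)\<^sup>2" by (simp only: abs_le_square_iff)
        then show ?thesis unfolding barrier_def c_def * using rate_pos[OF M] L by (intro mult_mono) (auto simp: \<alpha>_def)
      qed
      then have "\<delta> * barrier \<alpha> z \<le> - w p" using \<delta> mult_left_mono[of "barrier \<alpha> z" c \<delta>] by simp
      ultimately show False using gz by (simp add: g_def)
    qed
    then have zT: "z \<in> open_tube"
      using z(1) hz by (auto simp: open_tube_def closed_tube_def barrier_def less_le)
    obtain d where d: "d > 0" "ball z d \<subseteq> open_tube"
      using open_open_tube zT open_contains_ball by blast
    have line: "z + s *\<^sub>R axis j 1 \<in> open_tube" if "\<bar>s\<bar> < d" for s j
      using that d(2) by (auto simp: dist_norm subset_iff)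
    have "partial j (partial j w) z + \<delta> * barrier2 \<alpha> j z \<le> 0" for j
    proof -
      obtain B where B: "\<And>s. ((\<lambda>s. barrier \<alpha> (z + s *\<^sub>R axis j 1)) has_real_derivative B s) (at s)"
        "(B has_real_derivative barrier2 \<alpha> j z) (at 0)"
        using barrier_line_derivatives by blast
      show ?thesis
      proof (rule second_derivative_nonpos_at_max[OF d(1)])
        show "((\<lambda>s. g (z + s *\<^sub>R axis j 1)) has_real_derivative partial j w (z + s *\<^sub>R axis j 1) + \<delta> * B s) (at s)"
          if "\<bar>s\<bar> < d" for s
          unfolding g_def
          by (intro DERIV_add DERIV_partial DERIV_cmult B C2_onD(1)[OF w open_open_tube line[OF that]])
        show "((\<lambda>s. partial j w (z + s *\<^sub>R axis j 1) + \<delta> * B s) has_real_derivative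
          partial j (partial j w) z + \<delta> * barrier2 \<alpha> j z) (at 0)"
          using DERIV_add[OF DERIV_partial[of "partial j w" z 0 j] DERIV_cmult[OF B(2)], of \<delta>]
            C2_onD(2)[OF w open_open_tube zT, of j] by simp
        show "g (z + s *\<^sub>R axis j 1) \<le> g (z + 0 *\<^sub>R axis j 1)" if "\<bar>s\<bar> < d" for s
          using z(2)[of "z + s *\<^sub>R axis j 1"] line[OF that, of j] by (auto simp: open_tube_def closed_tube_def)
      qed
    qed
    then have "(\<Sum>j\<in>UNIV. partial j (partial j w) z + \<delta> * barrier2 \<alpha> j z) \<le> 0" by (rule sum_nonpos)
    then have "laplacian w z + \<delta> * (\<Sum>j\<in>UNIV. barrier2 \<alpha> j z) \<le> 0"
      by (simp add: laplacian_def sum.distrib sum_distrib_left)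
    moreover have "\<delta> * (M * barrier \<alpha> z) < \<delta> * (\<Sum>j\<in>UNIV. barrier2 \<alpha> j z)"
      using barrier_subsolution[OF M zT] \<delta>(1) by (simp add: \<alpha>_def)
    moreover have "M * g z \<ge> 0" using M gz by simp
    ultimately show False using sub[OF zT] by (simp add: g_def algebra_simps)
  qed
  then have "\<forall>x\<in>closed_tube. w x \<le> - \<delta> * barrier \<alpha> x"
    using z(2) by (force simp: g_def)
  then show ?thesis using \<delta>(1) unfolding \<alpha>_def by blast
qed

text \<open>On the axis of the tube \<open>radius_sq\<close> is 0, so \<open>w\<close> lies below a
  function of \<open>s\<close> that agrees with it at \<open>s = 0\<close> and has slope
  \<open>- \<delta> * rate M * \<rho>^4\<close> there.\<close>

lemma hopf_derivative:
  assumes "M \<ge> 0" and "\<delta> > 0" and cmp: "\<forall>x\<in>closed_tube. w x \<le> - \<delta> * barrier (rate M) x"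
    and "w x0 = 0" and der: "((\<lambda>s. w (x0 + s *\<^sub>R axis i 1)) has_real_derivative c) (at 0)"
  shows "c < 0"
proof (rule ccontr)
  assume "\<not> c < 0"
  let ?k = "\<lambda>s. w (x0 + s *\<^sub>R axis i 1) + \<delta> * ((exp (rate M * s) - 1) * (\<rho>\<^sup>2)\<^sup>2)"
  have "(?k has_real_derivative c + \<delta> * (rate M * (\<rho>\<^sup>2)\<^sup>2)) (at 0)"
    by (rule DERIV_add[OF der]) (auto intro!: derivative_eq_intros)
  moreover have "c + \<delta> * (rate M * (\<rho>\<^sup>2)\<^sup>2) > 0"
    using \<open>\<not> c < 0\<close> \<open>\<delta> > 0\<close> rate_pos[OF \<open>M \<ge> 0\<close>] \<rho> by (simp add: add_nonneg_pos)
  ultimately obtain r where r: "r > 0" "\<And>h. 0 < h \<Longrightarrow> h < r \<Longrightarrow> ?k 0 < ?k (0 + h)"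
    using DERIV_pos_inc_right by blast
  define h where "h = min r L / 2"
  have h: "0 < h" "h < r" "h \<le> L" using r L by (auto simp: h_def)
  have ht: "height (x0 + h *\<^sub>R axis i 1) = h" by (simp add: height_def)
  then have rad: "radius_sq (x0 + h *\<^sub>R axis i 1) = 0" by (simp add: radius_sq_dist)
  have "x0 + h *\<^sub>R axis i 1 \<in> closed_tube" using h \<rho> by (simp add: closed_tube_def ht rad)
  then have "?k h \<le> 0" using cmp ht rad by (force simp: barrier_def)
  moreover have "?k 0 = 0" using \<open>w x0 = 0\<close> by simp
  ultimately show False using r(2)[OF h(1,2)] by simp
qed

end

section \<open>Comparison of a solution with its images\<close>

lemma orthogonal_transformation_reflect_coord: "orthogonal_transformation (reflect_coord i)"
  unfolding orthogonal_transformation_def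
proof
  show "linear (reflect_coord i)"
    by (rule linearI) (simp_all add: reflect_coord_def vec_eq_iff)
  show "\<forall>v w. reflect_coord i v \<bullet> reflect_coord i w = v \<bullet> w"
    by (auto simp: reflect_coord_def inner_vec_def intro!: sum.cong)
qed

text \<open>\<open>axis_rotation\<close> admits all of O(n), including maps of determinant -1. Hence
  symmetry in every coordinate other than \<open>k\<close> comes from rotational invariance, and
  only coordinate \<open>k\<close> relies on the reflection clause.\<close>

lemma reflect_coord_axis_rotation: "i \<noteq> k \<Longrightarrow> axis_rotation k (reflect_coord i)"
  using orthogonal_transformation_reflect_coord[of i]
  by (auto simp: axis_rotation_def reflect_coord_def axis_def vec_eq_iff)

lemma axis_convexD:
  assumes "axis_convex i S" "x + a *\<^sub>R axis i 1 \<in> S" "x + b *\<^sub>R axis i 1 \<in> S" "a \<le> c" "c \<le> b"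
  shows "x + c *\<^sub>R axis i 1 \<in> S"
proof -
  have "closed_segment (x + a *\<^sub>R axis i 1) (x + b *\<^sub>R axis i 1) \<subseteq> S"
    using assms(1-3) unfolding axis_convex_def by (simp add: axis_def)
  moreover have "x + c *\<^sub>R axis i 1 \<in> closed_segment (x + a *\<^sub>R axis i 1) (x + b *\<^sub>R axis i 1)"
  proof -
    have "c \<in> closed_segment a b" using assms(4,5) by (simp add: closed_segment_eq_real_ivl)
    then obtain t where "0 \<le> t" "t \<le> 1" "c = (1 - t) * a + t * b" by (auto simp: in_segment)
    then show ?thesis
      by (auto simp: in_segment algebra_simps intro!: exI[of _ t] simp flip: scaleR_add_left)
  qed
  ultimately show ?thesis by blast
qed

section \<open>Stable solutions in a bounded open set\<close>

locale stable_problem =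
  fixes \<Omega> :: "(real^'n) set" and f :: "real \<Rightarrow> real" and u :: "real^'n \<Rightarrow> real"
  assumes \<Omega>: "open \<Omega>" and bdd: "bounded \<Omega>"
    and fC1: "f C1_differentiable_on UNIV" and fconv: "convex_on UNIV f"
    and uC2: "C2_on u \<Omega>" and ucont: "continuous_on (closure \<Omega>) u"
    and pde: "\<And>x. x \<in> \<Omega> \<Longrightarrow> - laplacian u x = f (u x)"
    and bc: "\<And>x. x \<in> frontier \<Omega> \<Longrightarrow> u x = 0"
    and pos: "\<And>x. x \<in> \<Omega> \<Longrightarrow> u x > 0"
    and stab: "stable_solution f \<Omega> u"
begin

abbreviation V :: "real^'n \<Rightarrow> real" where "V x \<equiv> deriv f (u x)"

lemma DERIV_f: "(f has_real_derivative deriv f s) (at s)"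
  using fC1 by (auto simp: C1_differentiable_on_eq real_differentiable_def field_differentiable_def
      intro!: DERIV_deriv_iff_real_differentiable[THEN iffD2])

lemma continuous_deriv_f: "continuous_on UNIV (deriv f)"
proof -
  have "vector_derivative f (at s) = deriv f s" for s
    using DERIV_f by (intro vector_derivative_at) (simp add: has_real_derivative_iff_has_vector_derivative)
  then show ?thesis using fC1 by (simp add: C1_differentiable_on_eq)
qed

text \<open>The tangent is taken at \<open>a\<close>, later the value \<open>u x\<close>, so that
  the resulting potential is the one in the stability hypothesis.\<close>

lemma convex_tangent: "f a - f b \<le> deriv f a * (a - b)"
  using convex_on_imp_above_tangent[OF fconv _ _ _ DERIV_f[of a], of b]
  by (simp add: algebra_simps)

lemma continuous_V: "continuous_on (closure \<Omega>) V"
  using continuous_on_compose2[OF continuous_deriv_f ucont] by simp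

lemma V_bound:
  obtains M where "M \<ge> 0" "\<And>x. x \<in> \<Omega> \<Longrightarrow> \<bar>V x\<bar> \<le> M"
proof -
  have "compact (V ` closure \<Omega>)"
    using continuous_V bdd by (intro compact_continuous_image) (simp_all add: compact_closure)
  then obtain M where M: "\<And>x. x \<in> closure \<Omega> \<Longrightarrow> norm (V x) \<le> M"
    using compact_imp_bounded bounded_iff by (metis imageI)
  have "\<bar>V x\<bar> \<le> max M 0" if "x \<in> \<Omega>" for x
    using M[of x] that closure_subset[of \<Omega>] by auto
  then show ?thesis by (intro that[of "max M 0"]) auto
qed

lemma closure_cases: "x \<in> closure \<Omega> \<Longrightarrow> x \<in> \<Omega> \<or> x \<in> frontier \<Omega>"
  using \<Omega> by (auto simp: frontier_def interior_open)

lemma u_nonneg: "x \<in> closure \<Omega> \<Longrightarrow> u x \<ge> 0"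
  using closure_cases[of x] pos[of x] bc[of x] by auto

text \<open>Convexity turns the difference of two solutions into a subsolution of the linearized
  operator at \<open>u\<close>.\<close>

lemma rigid_difference:
  fixes T :: "real^'n \<Rightarrow> real^'n"
  assumes D: "open D" "D \<subseteq> \<Omega>" and T: "orthogonal_transformation T"
    and A: "\<And>x. x \<in> D \<Longrightarrow> T x + b \<in> \<Omega>"
  shows "C2_on (\<lambda>x. u x - u (T x + b)) D"
    and "x \<in> D \<Longrightarrow> - laplacian (\<lambda>x. u x - u (T x + b)) x \<le> V x * (u x - u (T x + b))"
proof -
  note c = C2_on_subset[OF uC2 D(2)] C2_on_compose_rigid(1)[OF uC2 \<Omega> D(1) T A]
  show "C2_on (\<lambda>x. u x - u (T x + b)) D"
    by (rule C2_on_diff(1)[OF c(1,2) D(1)])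
  show "- laplacian (\<lambda>x. u x - u (T x + b)) x \<le> V x * (u x - u (T x + b))" if x: "x \<in> D"
  proof -
    have "- laplacian (\<lambda>x. u x - u (T x + b)) x = - laplacian u x - - laplacian u (T x + b)"
      using C2_on_diff(2)[OF c(1,2) D(1) x] C2_on_compose_rigid(2)[OF uC2 \<Omega> D(1) T A x] by simp
    also have "\<dots> = f (u x) - f (u (T x + b))" using pde A x D(2) by auto
    finally show ?thesis using convex_tangent by simp
  qed
qed

text \<open>At boundary points of \<open>D\<close> outside \<open>\<Omega>\<close> the inequality is
  automatic, as \<open>u\<close> is 0 there and nonnegative on the closure of
  \<open>\<Omega>\<close>. Only boundary points inside \<open>\<Omega>\<close> have to be
  supplied.\<close>

lemma rigid_comparison:
  fixes T :: "real^'n \<Rightarrow> real^'n"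
  assumes D: "open D" "D \<subseteq> \<Omega>" and T: "orthogonal_transformation T"
    and A: "\<And>x. x \<in> D \<Longrightarrow> T x + b \<in> \<Omega>"
    and bdry: "\<And>x. x \<in> frontier D \<Longrightarrow> x \<in> \<Omega> \<Longrightarrow> u x \<le> u (T x + b)"
    and "x \<in> D"
  shows "u x \<le> u (T x + b)"
proof -
  have cA: "continuous_on S (\<lambda>x. T x + b)" for S
    using orthogonal_transformation_linear[OF T] by (intro continuous_intros linear_continuous_on linear_conv_bounded_linear[THEN iffD1])
  have cl: "T x + b \<in> closure \<Omega>" if "x \<in> closure D" for x
  proof -
    have "(\<lambda>x. T x + b) ` closure D \<subseteq> closure ((\<lambda>x. T x + b) ` D)"
      by (rule image_closure_subset[OF cA closed_closure closure_subset])
    also have "\<dots> \<subseteq> closure \<Omega>" using A by (intro closure_mono) auto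
    finally show ?thesis using that by auto
  qed
  have D_cl: "closure D \<subseteq> closure \<Omega>" using D(2) by (rule closure_mono)
  obtain M where M: "\<And>x. x \<in> \<Omega> \<Longrightarrow> \<bar>V x\<bar> \<le> M" using V_bound by blast
  have "u x - u (T x + b) \<le> 0"
  proof (rule stable_maximum_principle[OF \<Omega> bdd _ M _ D rigid_difference(1)[OF D T A] _ _ _ \<open>x \<in> D\<close>])
    show "continuous_on \<Omega> V" using continuous_V closure_subset by (rule continuous_on_subset)
    show "first_dirichlet_eigenvalue \<Omega> V > 0" using stab by (simp add: stable_solution_def)
    show "continuous_on (closure D) (\<lambda>x. u x - u (T x + b))"
      using cl by (intro continuous_on_diff continuous_on_subset[OF ucont D_cl] continuous_on_compose2[OF ucont cA]) auto
    show "- laplacian (\<lambda>x. u x - u (T x + b)) x \<le> V x * (u x - u (T x + b))" if "x \<in> D" for x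
      using rigid_difference(2)[OF D T A that] .
    show "u x - u (T x + b) \<le> 0" if x: "x \<in> frontier D" for x
    proof (cases "x \<in> \<Omega>")
      case True
      then show ?thesis using bdry[OF x] by simp
    next
      case False
      have "x \<in> closure D" using x by (simp add: frontier_def)
      then show ?thesis using False closure_cases[of x] D_cl bc[of x] u_nonneg[OF cl[of x]] by auto
    qed
  qed
  then show ?thesis by simp
qed

text \<open>The comparison is applied to \<open>T\<close> and to its inverse. With \<open>D\<close>
  equal to \<open>\<Omega>\<close> the boundary condition is vacuous, since an open set misses its
  frontier.\<close>

lemma rotation_invariant:
  assumes T: "orthogonal_transformation T" and im: "T ` \<Omega> = \<Omega>" and x: "x \<in> \<Omega>"
  shows "u (T x) = u x"
proof -
  have le: "u x \<le> u (T x)" if T: "orthogonal_transformation T" and im: "T ` \<Omega> = \<Omega>" and "x \<in> \<Omega>" for T x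
  proof -
    have "u x \<le> u (T x + 0)"
    proof (rule rigid_comparison[OF \<Omega> order_refl T _ _ \<open>x \<in> \<Omega>\<close>])
      show "T x + 0 \<in> \<Omega>" if "x \<in> \<Omega>" for x using im that by auto
      show "u x \<le> u (T x + 0)" if "x \<in> frontier \<Omega>" "x \<in> \<Omega>" for x
        using that \<Omega> by (simp add: frontier_def interior_open)
    qed
    then show ?thesis by simp
  qed
  have inv: "orthogonal_transformation (inv T)" using T by (rule orthogonal_transformation_inv)
  have iT: "inv T (T y) = y" for y using orthogonal_transformation_inj[OF T] by simp
  have "inv T ` \<Omega> = inv T ` T ` \<Omega>" by (simp add: im)
  also have "\<dots> = \<Omega>" by (simp add: image_image iT)
  finally have "u (T x) \<le> u (inv T (T x))" using im x by (intro le[OF inv]) auto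
  then show ?thesis using le[OF T im x] by (simp add: iT)
qed

text \<open>The mirror plane is put through \<open>x0\<close> itself. Then \<open>w\<close> vanishes
  at \<open>x0\<close> and its slope along the axis is twice the partial derivative of
  \<open>u\<close>, so the sign follows from the Hopf estimate for \<open>w\<close>.\<close>

lemma partial_neg:
  assumes sym: "reflect_coord i ` \<Omega> = \<Omega>" and conv: "axis_convex i \<Omega>"
    and x0: "x0 \<in> \<Omega>" and l: "x0 $ i > 0"
  shows "partial i u x0 < 0"
proof -
  define l where "l = x0 $ i"
  have lpos: "l > 0" using assms(4) by (simp add: l_def)
  let ?e = "axis i 1 :: real^'n"
  \<comment> \<open>Reflecting in the plane at height \<open>l\<close> is reflecting in the
    coordinate hyperplane and then translating by \<open>2 * l\<close>.\<close>
  define b where "b = (2 * l) *\<^sub>R ?e"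
  define w where "w x = u x - u (reflect_coord i x + b)" for x
  have refl: "reflect_coord i x = x + (- 2 * x $ i) *\<^sub>R ?e" for x
    by (simp add: reflect_coord_def vec_eq_iff axis_def)
  have A: "reflect_coord i x + b = x + (2 * l - 2 * x $ i) *\<^sub>R ?e" for x
    unfolding refl b_def by (simp add: scaleR_left_diff_distrib scaleR_left_distrib)
  have Aline: "reflect_coord i (x0 + s *\<^sub>R ?e) + b = x0 + (- s) *\<^sub>R ?e" for s
    by (simp add: vec_eq_iff reflect_coord_def b_def l_def axis_def)
  \<comment> \<open>The image lies between \<open>x\<close> and its mirror point across the
    coordinate hyperplane, both of which are in \<open>\<Omega>\<close>; this uses
    \<open>l > 0\<close> as well as \<open>x $ i\<close> at least \<open>l\<close>.\<close>
  have A\<Omega>: "reflect_coord i x + b \<in> \<Omega>" if "x \<in> \<Omega>" "x $ i \<ge> l" for x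
    unfolding A
  proof (rule axis_convexD[OF conv])
    show "x + (- 2 * x $ i) *\<^sub>R ?e \<in> \<Omega>" using sym that(1) unfolding refl[symmetric] by blast
    show "x + 0 *\<^sub>R ?e \<in> \<Omega>" using that(1) by simp
  qed (use that lpos in auto)
  define D where "D = \<Omega> \<inter> {x. l < x $ i}"
  have half: "open {x :: real^'n. l < x $ i}" "closed {x :: real^'n. l \<le> x $ i}"
    by (intro open_Collect_less closed_Collect_le continuous_intros)+
  have D: "open D" "D \<subseteq> \<Omega>" using \<Omega> half by (auto simp: D_def)
  have AD: "reflect_coord i x + b \<in> \<Omega>" if "x \<in> D" for x
    using that by (intro A\<Omega>) (auto simp: D_def)
  note R = orthogonal_transformation_reflect_coord[of i]
  have plane: "w x = 0" if "x $ i = l" for x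
    using that by (simp add: w_def A)
  have wD: "w x \<le> 0" if "x \<in> D" for x
  proof -
    have "u x \<le> u (reflect_coord i x + b)"
    proof (rule rigid_comparison[OF D R AD _ that])
      fix x assume x: "x \<in> frontier D" "x \<in> \<Omega>"
      have "closure D \<subseteq> {x. l \<le> x $ i}" using half(2) by (intro closure_minimal) (auto simp: D_def)
      moreover have "x \<in> closure D" "x \<notin> D" using x(1) D(1) by (auto simp: frontier_def interior_open)
      ultimately have "x $ i = l" using x(2) by (force simp: D_def)
      then show "u x \<le> u (reflect_coord i x + b)" using plane[of x] by (simp add: w_def)
    qed
    then show ?thesis by (simp add: w_def)
  qed

  \<comment> \<open>Leaving \<open>\<Omega>\<close> along the axis, \<open>u\<close> tends to \<open>0\<close> while the mirror image stays inside,
    so \<open>w\<close> is negative near the exit point.\<close>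
  obtain L where L: "L > 0" "\<And>s. 0 \<le> s \<Longrightarrow> s \<le> L \<Longrightarrow> x0 + s *\<^sub>R ?e \<in> \<Omega>" "w (x0 + L *\<^sub>R ?e) < 0"
  proof -
    have line: "continuous_on S (\<lambda>s. x0 + s *\<^sub>R ?e)" "continuous_on S (\<lambda>s. x0 + (- s) *\<^sub>R ?e)" for S
      by (intro continuous_intros)+
    \<comment> \<open>The parameters at which the ray from \<open>x0\<close> is outside
      \<open>\<Omega>\<close>; the least one is the first exit.\<close>
    define J where "J = {0..} \<inter> (\<lambda>s. x0 + s *\<^sub>R ?e) -` (- \<Omega>)"
    have "closed J" unfolding J_def using \<Omega> line
      by (intro closed_Int continuous_closed_vimage) (auto simp: continuous_on_eq_continuous_at)
    moreover have "J \<noteq> {}"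
    proof -
      obtain B where B: "\<And>x. x \<in> \<Omega> \<Longrightarrow> norm x \<le> B" using bdd by (auto simp: bounded_iff)
      define s where "s = B + norm x0 + 1"
      have s: "s \<ge> 0" using B[OF x0] norm_ge_zero[of x0] unfolding s_def by linarith
      have "norm (s *\<^sub>R ?e) \<le> norm (x0 + s *\<^sub>R ?e) + norm x0"
        by (metis add_diff_cancel_left' norm_triangle_ineq4)
      then have "norm (x0 + s *\<^sub>R ?e) > B" using s by (simp add: s_def)
      then show ?thesis using B[of "x0 + s *\<^sub>R ?e"] s by (auto simp: J_def)
    qed
    moreover have J_bdd: "bdd_below J" by (rule bdd_belowI[of _ 0]) (simp add: J_def)
    ultimately have bJ: "Inf J \<in> J" by (intro closed_contains_Inf)
    define c where "c = Inf J"
    have c: "x0 + c *\<^sub>R ?e \<notin> \<Omega>" "c \<ge> 0" using bJ by (auto simp: J_def c_def)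
    then have cpos: "c > 0" using x0 by (cases "c = 0") auto
    have inside: "x0 + s *\<^sub>R ?e \<in> \<Omega>" if "0 \<le> s" "s < c" for s
      using cInf_lower[OF _ J_bdd, of s] that by (force simp: J_def c_def)
    \<comment> \<open>The exit point is not in \<open>\<Omega>\<close>, so its mirror point across
      the coordinate hyperplane is of no use. A point shortly before the exit serves instead: as
      \<open>s' > c - 2 * l\<close>, its mirror point lies beyond
      \<open>x0 + (- c) *\<^sub>R ?e\<close>, and convexity puts the latter inside
      \<open>\<Omega>\<close>.\<close>
    define s' where "s' = max 0 (c - l)"
    have s': "0 \<le> s'" "s' < c" "c - 2 * l < s'" using cpos lpos by (auto simp: s'_def)
    have "reflect_coord i (x0 + s' *\<^sub>R ?e) = x0 + (- 2 * l - s') *\<^sub>R ?e"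
      unfolding refl by (simp add: l_def axis_def algebra_simps flip: scaleR_add_left)
    then have "x0 + (- 2 * l - s') *\<^sub>R ?e \<in> \<Omega>" using inside[OF s'(1,2)] sym by (metis imageI)
    then have mirror: "x0 + (- s) *\<^sub>R ?e \<in> \<Omega>" if "0 \<le> s" "s \<le> c" for s
      using x0 that s' lpos by (intro axis_convexD[OF conv, of x0 "- 2 * l - s'" 0 "- s"]) auto
    have "x0 + c *\<^sub>R ?e \<in> closure \<Omega>"
    proof -
      have "(\<lambda>s. x0 + s *\<^sub>R ?e) ` closure {0..<c} \<subseteq> closure \<Omega>"
        using inside by (intro image_closure_subset[OF line(1) closed_closure]) (use closure_subset[of \<Omega>] in auto)
      then show ?thesis using cpos by auto
    qed
    then have "x0 + c *\<^sub>R ?e \<in> frontier \<Omega>" using closure_cases c(1) by blast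
    then have u0: "u (x0 + c *\<^sub>R ?e) = 0" by (rule bc)
    define g where "g s = u (x0 + s *\<^sub>R ?e) - u (x0 + (- s) *\<^sub>R ?e)" for s
    have cl: "x0 + s *\<^sub>R ?e \<in> closure \<Omega>" "x0 + (- s) *\<^sub>R ?e \<in> closure \<Omega>" if "s \<in> {0..c}" for s
      using that inside[of s] mirror[of s] \<open>x0 + c *\<^sub>R ?e \<in> closure \<Omega>\<close> closure_subset[of \<Omega>]
      by (cases "s = c"; force)+
    have "continuous_on {0..c} g"
      unfolding g_def using cl
      by (intro continuous_on_diff continuous_on_compose2[OF ucont line(1)] continuous_on_compose2[OF ucont line(2)]) auto
    moreover have gc: "g c < 0" using u0 pos[OF mirror[of c]] cpos by (simp add: g_def)
    ultimately obtain d where d: "d > 0" "\<And>s. s \<in> {0..c} \<Longrightarrow> dist s c < d \<Longrightarrow> dist (g s) (g c) < - g c"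
      using cpos unfolding continuous_on_iff by (metis atLeastAtMost_iff less_eq_real_def neg_0_less_iff_less)
    \<comment> \<open>Stopping just before the exit keeps the segment inside \<open>\<Omega>\<close>
      and \<open>g\<close> negative; the bound \<open>c / 2\<close> keeps \<open>L\<close>
      positive.\<close>
    define L where "L = max (c / 2) (c - d / 2)"
    have L: "0 < L" "L < c" "dist L c < d" using cpos d(1) by (auto simp: L_def dist_real_def max_def)
    have "g L < 0" using d(2)[of L] L by (auto simp: dist_real_def)
    moreover have "w (x0 + L *\<^sub>R ?e) = g L"
      unfolding w_def g_def Aline ..
    ultimately show thesis using L inside by (intro that[of L]) auto
  qed

  define z where "z = x0 + L *\<^sub>R ?e"
  have z: "z \<in> D" using L(1) L(2)[of L] lpos by (auto simp: D_def z_def l_def)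
  have wC2: "C2_on w D" unfolding w_def by (rule rigid_difference(1)[OF D R AD])
  have "open {x \<in> D. w x < 0}"
    using continuous_open_preimage[OF C2_on_continuous(1)[OF wC2] D(1), of "{..<0}"]
    by (simp add: vimage_def Int_def)
  then obtain r1 where r1: "r1 > 0" "ball z r1 \<subseteq> {x \<in> D. w x < 0}"
    using z L(3) by (auto simp: open_contains_ball z_def)
  have "compact ((\<lambda>s. x0 + s *\<^sub>R ?e) ` {0..L})"
    by (intro compact_continuous_image continuous_intros) simp
  moreover have "(\<lambda>s. x0 + s *\<^sub>R ?e) ` {0..L} \<subseteq> \<Omega>" using L(2) by auto
  ultimately obtain r2 where r2: "r2 > 0" "(\<Union>x\<in>(\<lambda>s. x0 + s *\<^sub>R ?e) ` {0..L}. ball x r2) \<subseteq> \<Omega>"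
    using compact_subset_open_imp_ball_epsilon_subset[OF _ \<Omega>] by blast
  \<comment> \<open>Below \<open>r1\<close> the top of the tube lies where \<open>w\<close> is
    negative; below \<open>r2\<close> the whole tube lies in \<open>\<Omega>\<close>.\<close>
  define \<rho> where "\<rho> = min r1 r2 / 2"
  have \<rho>_less: "\<rho> > 0" "\<rho> < r1" "\<rho> < r2" using r1(1) r2(1) by (auto simp: \<rho>_def)
  interpret tube x0 i L \<rho> using L(1) \<rho>_less(1) by unfold_locales
  have near: "dist x (x0 + height x *\<^sub>R ?e) \<le> \<rho>" if "x \<in> closed_tube" for x
    using that \<rho>_less(1) unfolding closed_tube_def radius_sq_dist by (simp add: power2_le_iff_abs_le)
  have hl: "height x = x $ i - l" for x by (simp add: height_def l_def)
  have tube\<Omega>: "x \<in> \<Omega>" "x $ i \<ge> l" if "x \<in> closed_tube" for x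
  proof -
    have h: "0 \<le> height x" "height x \<le> L" using that by (auto simp: closed_tube_def)
    have "x \<in> ball (x0 + height x *\<^sub>R ?e) r2" using near[OF that] \<rho>_less by (simp add: dist_commute)
    moreover have "x0 + height x *\<^sub>R ?e \<in> (\<lambda>s. x0 + s *\<^sub>R ?e) ` {0..L}" using h by auto
    ultimately show "x \<in> \<Omega>" using r2(2) by blast
    show "x $ i \<ge> l" using h hl[of x] by simp
  qed
  have tubeD: "open_tube \<subseteq> D"
    using tube\<Omega>(1) hl by (auto simp: D_def open_tube_def closed_tube_def)
  have cR: "continuous_on S (\<lambda>x. reflect_coord i x + b)" for S
    unfolding A by (intro continuous_intros)
  have wle: "w x \<le> 0" if "x \<in> closed_tube" for x
    using wD[of x] plane[of x] tube\<Omega>[OF that] by (cases "x $ i = l") (auto simp: D_def)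
  obtain M where M: "M \<ge> 0" "\<And>x. x \<in> \<Omega> \<Longrightarrow> \<bar>V x\<bar> \<le> M" using V_bound by blast
  have "\<exists>\<delta>>0. \<forall>x\<in>closed_tube. w x \<le> - \<delta> * barrier (rate M) x"
  proof (rule barrier_comparison[OF M(1) _ C2_on_subset[OF wC2 tubeD] wle])
    show "continuous_on closed_tube w"
      unfolding w_def using tube\<Omega> A\<Omega> closure_subset[of \<Omega>]
      by (intro continuous_on_diff continuous_on_subset[OF ucont] continuous_on_compose2[OF ucont cR]) blast+
    show "w x < 0" if "x \<in> closed_tube" "height x = L" for x
    proof -
      have "x \<in> ball z r1" using near[OF that(1)] \<rho>_less that(2) by (simp add: z_def dist_commute)
      then show ?thesis using r1(2) by auto
    qed
    show "M * w x \<le> laplacian w x" if "x \<in> open_tube" for x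
    proof -
      have x: "x \<in> D" using that tubeD by auto
      have "- laplacian w x \<le> V x * w x"
        unfolding w_def by (rule rigid_difference(2)[OF D R AD x])
      \<comment> \<open>Since \<open>w\<close> is nonpositive, replacing \<open>V\<close> by its
        lower bound \<open>- M\<close> increases the product.\<close>
      also have "\<dots> \<le> (- M) * w x"
        using M(2)[of x] x D(2) wD[OF x] by (intro mult_right_mono_neg) auto
      finally show ?thesis by simp
    qed
  qed
  then obtain \<delta> where \<delta>: "\<delta> > 0" "\<forall>x\<in>closed_tube. w x \<le> - \<delta> * barrier (rate M) x" by blast
  have "((\<lambda>s. w (x0 + s *\<^sub>R ?e)) has_real_derivative 2 * partial i u x0) (at 0)"
  proof -
    have d: "u differentiable (at (x0 + 0 *\<^sub>R ?e))" using C2_onD(1)[OF uC2 \<Omega> x0] by simp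
    have "((\<lambda>s. u (x0 + s *\<^sub>R ?e)) has_real_derivative partial i u x0) (at 0)"
      using DERIV_partial[OF d] by simp
    moreover have "((\<lambda>s. u (x0 + s *\<^sub>R ?e)) has_real_derivative partial i u x0) (at (- 0))"
      using DERIV_partial[OF d] by simp
    then have "((\<lambda>s. u (x0 + (- s) *\<^sub>R ?e)) has_real_derivative - partial i u x0) (at 0)"
      by (subst (asm) DERIV_mirror) simp
    ultimately have "((\<lambda>s. u (x0 + s *\<^sub>R ?e) - u (x0 + (- s) *\<^sub>R ?e)) has_real_derivative
        partial i u x0 - - partial i u x0) (at 0)"
      by (rule DERIV_diff)
    moreover have "w (x0 + s *\<^sub>R ?e) = u (x0 + s *\<^sub>R ?e) - u (x0 + (- s) *\<^sub>R ?e)" for s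
      unfolding w_def Aline ..
    ultimately show ?thesis by simp
  qed
  then have "2 * partial i u x0 < 0"
    using plane[of x0] by (intro hopf_derivative[OF M(1) \<delta>]) (simp_all add: l_def)
  then show ?thesis by simp
qed

end

text \<open>The Householder reflection exchanging \<open>y\<close> with \<open>norm y *\<^sub>R axis i 1\<close>.\<close>

lemma axis_rotation_to_coordinate:
  fixes y :: "real^'n"
  assumes "y $ k = 0" "i \<noteq> k"
  obtains T where "axis_rotation k T" "T y = norm y *\<^sub>R axis i 1"
proof -
  let ?e = "axis i 1 :: real^'n"
  define a where "a = y - norm y *\<^sub>R ?e"
  \<comment> \<open>If \<open>a\<close> is 0 the quotient is 0 and \<open>T\<close> is the identity,
    as it should be: \<open>y\<close> then already has the desired direction.\<close>
  define T where "T x = x - (2 * (a \<bullet> x) / (a \<bullet> a)) *\<^sub>R a" for x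
  have "linear T"
    by (rule linearI) (simp_all add: T_def inner_add_right algebra_simps add_divide_distrib)
  moreover have "T v \<bullet> T x = v \<bullet> x" for v x
  proof (cases "a = 0")
    case False
    then show ?thesis
      by (simp add: T_def inner_diff_left inner_diff_right inner_commute field_simps)
  qed (simp add: T_def)
  moreover have "T (axis k 1) = axis k 1"
  proof -
    have "a \<bullet> axis k 1 = a $ k" by (simp add: inner_axis)
    also have "\<dots> = 0" using assms by (simp add: a_def axis_def)
    finally have "a \<bullet> axis k 1 = 0" .
    then show ?thesis by (simp add: T_def)
  qed
  moreover have "T y = norm y *\<^sub>R ?e"
  proof (cases "a = 0")
    case False
    \<comment> \<open>This holds because \<open>y\<close> and its target have equal norms.\<close>
    have "a \<bullet> a = 2 * (a \<bullet> y)"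
      unfolding a_def inner_diff_left inner_diff_right
      by (simp add: inner_commute[of _ y] flip: power2_norm_eq_inner)
    moreover have "a \<bullet> a \<noteq> 0" using False by simp
    ultimately have "2 * (a \<bullet> y) / (a \<bullet> a) = 1" by (metis divide_self)
    then have "T y = y - a" by (simp only: T_def scaleR_one)
    then show ?thesis by (simp add: a_def)
  qed (simp add: T_def a_def)
  ultimately show thesis by (intro that[of T]) (auto simp: axis_rotation_def orthogonal_transformation_def)
qed

theorem theorem1p2:
  fixes \<Omega> :: "(real^'n) set" and k :: 'n
    and f :: "real \<Rightarrow> real" and u :: "real^'n \<Rightarrow> real"
  assumes n3: "CARD('n) \<ge> 3"
    and dom: "is_domain \<Omega>" and bdd: "bounded \<Omega>"
    and sym: "simple_rot_sym k \<Omega>"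
    and fC1: "f C1_differentiable_on UNIV" and fconv: "convex_on UNIV f"
    and uC2: "C2_on u \<Omega>" and ucont: "continuous_on (closure \<Omega>) u"
    and pde: "\<forall>x\<in>\<Omega>. - laplacian u x = f (u x)"
    and bc: "\<forall>x\<in>frontier \<Omega>. u x = 0"
    and pos: "\<forall>x\<in>\<Omega>. u x > 0"
    and stab: "stable_solution f \<Omega> u"
  shows "(\<forall>T. axis_rotation k T \<longrightarrow> (\<forall>x\<in>\<Omega>. u (T x) = u x))
       \<and> (\<forall>x\<in>\<Omega>. x $ k > 0 \<longrightarrow> partial k u x < 0)
       \<and> (\<forall>i. i \<noteq> k \<longrightarrow> (\<forall>x\<in>\<Omega>. x $ i \<noteq> 0 \<longrightarrow> x $ i * partial i u x < 0))
       \<and> (\<forall>x\<in>\<Omega>. horiz k x \<noteq> 0 \<longrightarrow>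
            deriv (\<lambda>r. u (x + r *\<^sub>R (horiz k x /\<^sub>R norm (horiz k x)))) 0 < 0)"
proof -
  interpret stable_problem \<Omega> f u
    by unfold_locales (use assms in \<open>auto simp: is_domain_def\<close>)
  have rot: "T ` \<Omega> = \<Omega>" if "axis_rotation k T" for T
    using sym that by (auto simp: simple_rot_sym_def)
  have inv: "u (T x) = u x" if "axis_rotation k T" "x \<in> \<Omega>" for T x
    using that rot by (intro rotation_invariant) (auto simp: axis_rotation_def)
  have refl: "reflect_coord i ` \<Omega> = \<Omega>" for i
    using sym rot[OF reflect_coord_axis_rotation[of i k]] by (cases "i = k") (auto simp: simple_rot_sym_def)
  have conv: "axis_convex i \<Omega>" for i using sym by (simp add: simple_rot_sym_def)
  note neg = partial_neg[OF refl conv]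
  \<comment> \<open>For negative \<open>x $ i\<close> the reflection in coordinate \<open>i\<close>,
    which leaves \<open>u\<close> invariant because \<open>i\<close> differs from \<open>k\<close>,
    makes the partial derivative odd and reduces to the positive side.\<close>
  have odd: "x $ i * partial i u x < 0" if i: "i \<noteq> k" and x: "x \<in> \<Omega>" "x $ i \<noteq> 0" for i x
  proof (cases "x $ i > 0")
    case True
    then show ?thesis using neg[OF x(1), of i] by (simp add: mult_pos_neg)
  next
    case False
    let ?y = "reflect_coord i x"
    have y: "?y \<in> \<Omega>" "?y $ i > 0" using refl[of i] x False by (auto simp: reflect_coord_def)
    have "partial i u x = - partial i u ?y"
    proof -
      have "((\<lambda>t. u (?y + t *\<^sub>R axis i 1)) has_real_derivative partial i u ?y) (at (- 0))"
        using DERIV_partial[of u ?y 0 i] C2_onD(1)[OF uC2 \<Omega> y(1)] by simp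
      then have "((\<lambda>t. u (?y + (- t) *\<^sub>R axis i 1)) has_real_derivative - partial i u ?y) (at 0)"
        by (subst (asm) DERIV_mirror) simp
      moreover have "deriv (\<lambda>t. u (x + t *\<^sub>R axis i 1)) 0 = deriv (\<lambda>t. u (?y + (- t) *\<^sub>R axis i 1)) 0"
      proof (rule deriv_cong_ev)
        from eventually_line_in_open[OF \<Omega> x(1), of "axis i 1"]
        show "\<forall>\<^sub>F t in nhds 0. u (x + t *\<^sub>R axis i 1) = u (?y + (- t) *\<^sub>R axis i 1)"
        proof eventually_elim
          case (elim t)
          have "reflect_coord i (x + t *\<^sub>R axis i 1) = ?y + (- t) *\<^sub>R axis i 1"
            by (simp add: reflect_coord_def vec_eq_iff axis_def)
          then show ?case using inv[OF reflect_coord_axis_rotation[OF i] elim] by simp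
        qed
      qed simp
      ultimately show ?thesis unfolding partial_def by (simp add: DERIV_imp_deriv)
    qed
    moreover have "partial i u ?y < 0" using neg[OF y] .
    ultimately show ?thesis using False x(2) by (simp add: mult_neg_neg)
  qed
  \<comment> \<open>An axis rotation turns the radial direction at \<open>x\<close> into a
    coordinate axis. The radial derivative becomes \<open>partial i u\<close> at \<open>T x\<close>,
    whose coordinate \<open>i\<close> is the norm of \<open>horiz k x\<close> and hence
    positive.\<close>
  have rad: "deriv (\<lambda>r. u (x + r *\<^sub>R (horiz k x /\<^sub>R norm (horiz k x)))) 0 < 0"
    if x: "x \<in> \<Omega>" and h: "horiz k x \<noteq> 0" for x
  proof -
    have hk: "horiz k x $ k = 0" by (simp add: horiz_def axis_def)
    obtain i where i: "i \<noteq> k" using h hk by (metis vec_eq_iff zero_index)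
    obtain T where T: "axis_rotation k T" "T (horiz k x) = norm (horiz k x) *\<^sub>R axis i 1"
      using axis_rotation_to_coordinate[OF hk i] by blast
    interpret T: linear T using T(1) by (simp add: axis_rotation_def orthogonal_transformation_def)
    define n where "n = norm (horiz k x)"
    have n: "n > 0" using h by (simp add: n_def)
    have Tx\<Omega>: "T x \<in> \<Omega>" using rot[OF T(1)] x by auto
    have "x = horiz k x + (x $ k) *\<^sub>R axis k 1" by (simp add: horiz_def)
    then have "T x = T (horiz k x) + (x $ k) *\<^sub>R T (axis k 1)" by (metis T.add T.scale)
    also have "\<dots> = n *\<^sub>R axis i 1 + (x $ k) *\<^sub>R axis k 1" using T by (simp add: n_def axis_rotation_def)
    finally have "T x $ i = n" using i by (simp add: axis_def)
    then have "partial i u (T x) < 0" using neg[OF Tx\<Omega>] n by simp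
    moreover have "deriv (\<lambda>r. u (x + r *\<^sub>R (horiz k x /\<^sub>R n))) 0 = partial i u (T x)"
      unfolding partial_def
    proof (rule deriv_cong_ev)
      from eventually_line_in_open[OF \<Omega> x, of "horiz k x /\<^sub>R n"]
      show "\<forall>\<^sub>F t in nhds 0. u (x + t *\<^sub>R (horiz k x /\<^sub>R n)) = u (T x + t *\<^sub>R axis i 1)"
      proof eventually_elim
        case (elim t)
        have "T (x + t *\<^sub>R (horiz k x /\<^sub>R n)) = T x + t *\<^sub>R axis i 1"
          using n T(2) by (simp add: T.add T.scale n_def)
        then show ?case using inv[OF T(1) elim] by simp
      qed
    qed simp
    ultimately show ?thesis by (simp add: n_def)
  qed
  show ?thesis using inv neg odd rad by blast
qed

end
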